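(* Let $\mathbf{e}=(e_1,\dots,e_k)\in\mathbb{Z}^k$ be a nonzero vector with $e_m\ge 0$ for all $m$. Let $d:=\gcd\{m : e_m\neq 0\}$, and define $$\gamma:=\sum_{n=1}^{k/d} e_{dn},\qquad \delta:=\sum_{n=1}^{k/d}\frac{e_{dn}}{n},\qquad \lambda:=\prod_{m=1}^{k}\left(\frac{m}{2\pi}\right)^{\frac{e_{dm}}{2}},\qquad A:=\frac{\pi^2\delta}{6},$$ where $e_{j}:=0$ for $j>k$. Then, as $n\to\infty$, $$p(dn)_{\mathbf{e}}\sim\frac{\lambda A^{\frac{1+\gamma}{4}}}{2\sqrt{\pi}\,n^{\frac{3+\gamma}{4}}}\,e^{2\sqrt{An}}.$$
   Context: For $\mathbf{e}=(e_1,\dots,e_k)\in\mathbb{Z}^k$, the generalized partition function $p(n)_{\mathbf{e}}$ is defined by the power series identity $$\sum_{n=0}^{\infty}p(n)_{\mathbf{e}}q^n=\prod_{m=1}^{k}\prod_{n=1}^{\infty}\frac{1}{(1-q^{mn})^{e_m}}.$$ *)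

theory Defs
  imports "HOL-Analysis.Analysis" "HOL-Library.Landau_Symbols"
begin

text \<open>
  A vector \<open>(e\<^sub>1, \<dots>, e\<^sub>k)\<close> of integers is encoded by its length \<open>k\<close> and a function
  \<open>e\<close> of which only the values at \<open>1, \<dots>, k\<close> are used. The infinite products are limits in the
  metric topology of formal power series, in which they always converge; their index starts at 0,
  hence the \<open>Suc n\<close>. The coefficients are integers, but are regarded as reals.
\<close>

definition gen_partition :: "nat \<Rightarrow> (nat \<Rightarrow> int) \<Rightarrow> nat \<Rightarrow> real" where
  "gen_partition k e N =
     fps_nth (\<Prod>m=1..k. \<Prod>n. 1 / (1 - fps_X ^ (m * Suc n)) powi e m) N"

end

theory Submission
  imports Defs "HOL-Probability.Probability" "HOL-Real_Asymp.Real_Asymp"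
    "HOL-Computational_Algebra.Formal_Laurent_Series"
begin

text \<open>
  After dividing out \<open>d\<close>, the exponents have a support with gcd 1. The coefficient is a Fourier
  integral of the generating function \<open>F\<close> over the circle of radius \<open>exp (- x)\<close>, where \<open>x = sqrt (A / n)\<close>
  is the saddle point. Rescaling the angle to \<open>\<theta> = x powr (3 / 2) * t\<close>, the integrand divided by its value
  at \<open>\<theta> = 0\<close> tends pointwise to \<open>exp (- A * t\<^sup>2)\<close>. It is dominated by a multiple of \<open>1 / (1 + t\<^sup>2)\<close> on the whole
  circle: keeping only the first order term of each logarithm, \<open>\<bar>F\<bar>\<close> loses a factor controlled by the
  distances of \<open>m * \<theta>\<close> to the multiples of \<open>2 * pi\<close>, and by Bezout these cannot all be small unless that of
  \<open>\<theta>\<close> is. So dominated convergence replaces the division into major and minor arcs. The constant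
  comes from \<open>ln F\<close> at \<open>exp (- x)\<close>, by comparing its sum with the trapezoid rule and using
  Stirling's formula, which follows from the Wallis product.
\<close>

text \<open>Near the real axis \<open>ln F\<close> behaves like
  \<open>A / (x + \<i> * \<theta>)\<close>, that is \<open>A / x - \<i> * A * \<theta>^2 / (x^2 *
  \<theta>) - A * \<theta>^2 / x^3\<close> up to an error of order \<open>\<theta>^3 / x^4\<close>.
  The quadratic term has order one exactly when \<open>\<theta>\<close> has order
  \<open>x powr (3 / 2)\<close>, and the error is then of order \<open>sqrt x\<close>. The linear
  term stays large, but \<open>n * x^2 = A\<close> at the saddle point, so it cancels the phase
  \<open>n * \<theta>\<close> of the Fourier kernel. On the real axis one factor contributes
  \<open>pi^2 / (6 * x) + ln (x / (2 * pi)) / 2\<close>. Replacing \<open>x\<close> by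
  \<open>m * x\<close> and summing with the weights \<open>e m\<close> gives \<open>A / x\<close>,
  the constant \<lambda> and the power \<open>x powr (\<gamma> / 2)\<close>. The Gaussian peak
  contributes \<open>x powr (3 / 2) * sqrt (pi / A) / (2 * pi)\<close>. With
  \<open>x = sqrt (A / n)\<close> this explains the exponents \<open>(3 + \<gamma>) / 4\<close> of
  \<open>n\<close> and \<open>(1 + \<gamma>) / 4\<close> of \<open>A\<close>. The obstacle is the
  rest of the circle: every root of unity is a singularity, and the available loss in the exponent
  saturates at order \<open>1 / x\<close>, so that a Gaussian majorant is out of reach.\<close>

section \<open>Logarithm of the partition product\<close>

text \<open>Expanding the logarithms in \<open>\<Sum>n\<ge>1. - ln (1 - q ^ n)\<close> and summing over \<open>n\<close> first gives this
  series, so that \<open>exp (plog q)\<close> is the generating function of all partitions.\<close>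

definition plog :: "'a::{real_normed_field,banach} \<Rightarrow> 'a" where
  "plog q = (\<Sum>j. q ^ Suc j / (of_nat (Suc j) * (1 - q ^ Suc j)))"

lemma norm_plog_term_le:
  fixes q :: "'a::{real_normed_field,banach}"
  assumes "norm q < 1"
  shows "norm (q ^ Suc j / (of_nat (Suc j) * (1 - q ^ Suc j))) \<le> norm q ^ Suc j / (1 - norm q)"
proof -
  have "norm q ^ Suc j \<le> norm q"
    using power_decreasing[of 1 "Suc j" "norm q"] assms by simp
  moreover have "1 - norm q ^ Suc j \<le> norm (1 - q ^ Suc j)"
    using norm_triangle_ineq2[of 1 "q ^ Suc j"] by (simp add: norm_power norm_mult)
  ultimately have 1: "1 - norm q \<le> norm (1 - q ^ Suc j)" by linarith
  have "1 * (1 - norm q) \<le> real (Suc j) * norm (1 - q ^ Suc j)"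
    using 1 assms by (intro mult_mono) auto
  then show ?thesis
    using assms by (simp only: norm_divide norm_mult norm_of_nat norm_power)
      (intro divide_left_mono mult_pos_pos, auto)
qed

lemma summable_plog:
  fixes q :: "'a::{real_normed_field,banach}"
  assumes "norm q < 1"
  shows "summable (\<lambda>j. q ^ Suc j / (of_nat (Suc j) * (1 - q ^ Suc j)))"
proof (rule summable_comparison_test')
  have "summable (\<lambda>j. norm q ^ j * (norm q / (1 - norm q)))"
    using assms by (intro summable_mult2 summable_geometric) auto
  then show "summable (\<lambda>j. norm q ^ Suc j / (1 - norm q))"
    by (simp add: mult_ac)
qed (use norm_plog_term_le[OF assms] in auto)

lemma plog_of_real:
  assumes "\<bar>q\<bar> < 1"
  shows "plog (complex_of_real q) = of_real (plog q)"
proof -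
  have "(\<lambda>j. q ^ Suc j / (of_nat (Suc j) * (1 - q ^ Suc j))) sums plog q"
    unfolding plog_def using assms by (intro summable_sums summable_plog) auto
  from sums_of_real[OF this, where ?'a = complex] show ?thesis
    unfolding plog_def by (auto simp: sums_iff)
qed

lemma sums_neg_Ln_one_minus:
  fixes z :: complex
  assumes "norm z < 1"
  shows "(\<lambda>j. z ^ Suc j / of_nat (Suc j)) sums (- Ln (1 - z))"
proof -
  have "(\<lambda>n. (-1) ^ Suc n / of_nat n * (-z) ^ n) sums Ln (1 + (-z))"
    using assms by (intro Ln_series) auto
  then have "(\<lambda>n. - ((-1) ^ Suc n / of_nat n * (-z) ^ n)) sums (- Ln (1 - z))"
    using sums_minus by fastforce
  moreover have "- ((-1) ^ Suc n / of_nat n * (-z) ^ n) = z ^ n / of_nat n" for n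
    by (cases "even n") (simp_all add: power_minus_odd)
  ultimately have "(\<lambda>n. z ^ n / of_nat n) sums (- Ln (1 - z))" by (simp only:)
  then show ?thesis using sums_Suc_iff[of "\<lambda>n. z ^ n / of_nat n" "- Ln (1 - z)"] by simp
qed

lemma sums_neg_ln_one_minus:
  fixes z :: real
  assumes "\<bar>z\<bar> < 1"
  shows "(\<lambda>j. z ^ Suc j / of_nat (Suc j)) sums (- ln (1 - z))"
proof -
  have "(\<lambda>j. complex_of_real (z ^ Suc j / of_nat (Suc j))) sums of_real (- ln (1 - z))"
    using sums_neg_Ln_one_minus[of "of_real z"] assms by (simp flip: Ln_of_real)
  then show ?thesis by (simp only: sums_of_real_iff)
qed

text \<open>For finite \<open>K\<close> the logarithmic series can be added term by term, and each
  term contains a partial geometric sum in \<open>n\<close>. Tannery's theorem then lets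
  \<open>K\<close> grow, with a majorant independent of \<open>K\<close>.\<close>

lemma sum_neg_Ln_tendsto_plog:
  fixes q :: complex
  assumes q: "norm q < 1"
  shows "(\<lambda>K. \<Sum>n\<le>K. - Ln (1 - q ^ Suc n)) \<longlonglongrightarrow> plog q"
proof -
  have q': "norm (q ^ Suc n) < 1" for n
    using q power_less_one_iff[of "norm q" "Suc n"] by (simp add: norm_power del: power_Suc)
  have eq: "(\<Sum>n\<le>K. - Ln (1 - q ^ Suc n)) = (\<Sum>j. \<Sum>n\<le>K. (q ^ Suc n) ^ Suc j / of_nat (Suc j))" for K
    using sums_sum[of "{..K}", OF sums_neg_Ln_one_minus[OF q']] by (simp add: sums_iff del: power_Suc)
  have geo: "(\<lambda>n. (q ^ Suc n) ^ Suc j / of_nat (Suc j)) sums (q ^ Suc j / (of_nat (Suc j) * (1 - q ^ Suc j)))" for j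
  proof -
    have "(\<lambda>n. q ^ Suc j / of_nat (Suc j) * (q ^ Suc j) ^ n) sums (q ^ Suc j / of_nat (Suc j) * (1 / (1 - q ^ Suc j)))"
      by (intro sums_mult geometric_sums q')
    moreover have "(q ^ Suc n) ^ Suc j = q ^ Suc j * (q ^ Suc j) ^ n" for n
      unfolding power_mult[symmetric] power_add[symmetric] by (simp add: algebra_simps)
    ultimately show ?thesis by (simp del: power_Suc)
  qed
  have bound: "norm (\<Sum>n\<le>K. (q ^ Suc n) ^ Suc j / of_nat (Suc j)) \<le> norm q ^ Suc j / (1 - norm q)" for K j
  proof -
    have "norm (\<Sum>n\<le>K. (q ^ Suc n) ^ Suc j / of_nat (Suc j)) \<le> (\<Sum>n\<le>K. norm q ^ Suc j * norm q ^ n)"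
    proof (rule sum_norm_le)
      fix n
      have "norm ((q ^ Suc n) ^ Suc j / of_nat (Suc j)) = norm q ^ (Suc n * Suc j) / real (Suc j)"
        by (simp only: norm_divide norm_power power_mult norm_of_nat)
      also have "\<dots> \<le> norm q ^ (Suc n * Suc j)"
        by (simp add: divide_le_eq mult_le_cancel_left1 del: power_Suc)
      \<comment> \<open>\<open>(n + 1) * (j + 1)\<close> exceeds \<open>(j + 1) + n\<close> by
        \<open>n * j\<close>; the smaller exponent separates \<open>n\<close> from
        \<open>j\<close>.\<close>
      also have "\<dots> \<le> norm q ^ (Suc j + n)"
        using q by (intro power_decreasing) auto
      finally show "norm ((q ^ Suc n) ^ Suc j / of_nat (Suc j)) \<le> norm q ^ Suc j * norm q ^ n"
        by (simp add: power_add)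
    qed
    also have "\<dots> = norm q ^ Suc j * (\<Sum>n\<le>K. norm q ^ n)"
      by (simp add: sum_distrib_left)
    also have "\<dots> \<le> norm q ^ Suc j * (1 / (1 - norm q))"
      using q suminf_geometric[of "norm q"] sum_le_suminf[of "\<lambda>n. norm q ^ n" "{..K}"]
      by (intro mult_left_mono) (auto intro: summable_geometric)
    finally show ?thesis by simp
  qed
  have "((\<lambda>K. \<Sum>j. \<Sum>n\<le>K. (q ^ Suc n) ^ Suc j / of_nat (Suc j)) \<longlongrightarrow> plog q) sequentially"
    unfolding plog_def
  proof (rule conjunct2[OF conjunct2[OF tannerys_theorem]])
    show "((\<lambda>K. \<Sum>n\<le>K. (q ^ Suc n) ^ Suc j / of_nat (Suc j)) \<longlonglongrightarrow> q ^ Suc j / (of_nat (Suc j) * (1 - q ^ Suc j)))" for j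
      using geo[of j] by (simp only: sums_def_le)
    have "summable (\<lambda>j. norm q ^ j * (norm q / (1 - norm q)))"
      using q by (intro summable_mult2 summable_geometric) auto
    then show "summable (\<lambda>j. norm q ^ Suc j / (1 - norm q))"
      by (simp add: mult_ac)
  qed (use bound in \<open>auto intro!: always_eventually\<close>)
  then show ?thesis by (simp only: eq)
qed

text \<open>A sum of principal logarithms need not be the principal logarithm of the product;
  exponentiating removes the ambiguity.\<close>

lemma prod_tendsto_exp_plog:
  fixes q :: complex
  assumes q: "norm q < 1"
  shows "(\<lambda>K. \<Prod>n\<le>K. 1 / (1 - q ^ Suc n)) \<longlonglongrightarrow> exp (plog q)"
proof -
  have "q ^ Suc n \<noteq> 1" for n
    using q power_less_one_iff[of "norm q" "Suc n"] norm_power[of q "Suc n"] by (auto simp del: power_Suc)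
  then have "(\<Prod>n\<le>K. 1 / (1 - q ^ Suc n)) = exp (\<Sum>n\<le>K. - Ln (1 - q ^ Suc n))" for K
    by (simp add: exp_sum exp_minus inverse_eq_divide del: power_Suc)
  with tendsto_exp[OF sum_neg_Ln_tendsto_plog[OF q]] show ?thesis
    by simp
qed

lemma sums_neg_ln_plog:
  fixes q :: real
  assumes q: "0 \<le> q" "q < 1"
  shows "(\<lambda>n. - ln (1 - q ^ Suc n)) sums plog q"
proof -
  have "q ^ Suc n < 1" for n
    using q power_less_one_iff[of "q" "Suc n"] by (simp del: power_Suc)
  then have "complex_of_real (\<Sum>n\<le>K. - ln (1 - q ^ Suc n)) = (\<Sum>n\<le>K. - Ln (1 - of_real q ^ Suc n))" for K
    by (simp flip: Ln_of_real add: of_real_power del: power_Suc)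
  then have "(\<lambda>K. complex_of_real (\<Sum>n\<le>K. - ln (1 - q ^ Suc n))) \<longlonglongrightarrow> of_real (plog q)"
    using sum_neg_Ln_tendsto_plog[of "of_real q"] plog_of_real[of q] q by (simp del: power_Suc)
  then show ?thesis
    by (simp only: sums_def_le tendsto_of_real_iff)
qed

section \<open>Behaviour at the singularity along the real axis\<close>

text \<open>The value at \<open>exp (- y)\<close> of the dilogarithm: an antiderivative of \<open>ln (1 - exp (- y))\<close>.\<close>

definition dilog :: "real \<Rightarrow> real" where
  "dilog y = (\<Sum>j. exp (- y) ^ Suc j / real (Suc j) ^ 2)"

lemma summable_inverse_squares: "summable (\<lambda>j. 1 / real (Suc j) ^ 2)"
  using inverse_squares_sums by (simp add: sums_iff add.commute)

lemma suminf_inverse_squares: "(\<Sum>j. 1 / real (Suc j) ^ 2) = pi\<^sup>2 / 6"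
  using inverse_squares_sums by (simp add: sums_iff add.commute)

lemma norm_dilog_term_le:
  assumes "y \<ge> 0"
  shows "norm (exp (- y) ^ Suc j / real (Suc j) ^ 2) \<le> 1 / real (Suc j) ^ 2"
  using assms by (auto simp: divide_right_mono power_le_one simp del: power_Suc of_nat_Suc)

lemma summable_dilog:
  assumes "y \<ge> 0"
  shows "summable (\<lambda>j. exp (- y) ^ Suc j / real (Suc j) ^ 2)"
  by (rule summable_comparison_test'[OF summable_inverse_squares]) (use norm_dilog_term_le[OF assms] in blast)

lemma dilog_0: "dilog 0 = pi\<^sup>2 / 6"
  unfolding dilog_def using suminf_inverse_squares by simp

text \<open>Continuity matters at the endpoint \<open>0\<close>, where the derivative is unbounded:
  it lets the mean value theorem in \<open>dilog_increment_bound\<close> start at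
  \<open>a = 0\<close>.\<close>

lemma continuous_on_dilog: "continuous_on {0..} dilog"
proof -
  have "uniform_limit {0..} (\<lambda>n y. \<Sum>j<n. exp (- y) ^ Suc j / real (Suc j) ^ 2) dilog sequentially"
    unfolding dilog_def
    by (rule Weierstrass_m_test[OF _ summable_inverse_squares]) (use norm_dilog_term_le in auto)
  then show ?thesis
    by (rule uniform_limit_theorem[rotated]) (auto intro!: always_eventually continuous_intros)
qed

lemma dilog_tendsto_0: "(dilog \<longlongrightarrow> 0) at_top"
proof (rule Lim_null_comparison)
  show "\<forall>\<^sub>F y in at_top. norm (dilog y) \<le> exp (- y) * (pi\<^sup>2 / 6)"
    using eventually_ge_at_top[of 0]
  proof eventually_elim
    case (elim y)
    have "norm (dilog y) \<le> (\<Sum>j. exp (- y) * (1 / real (Suc j) ^ 2))"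
      unfolding dilog_def
    proof (rule norm_suminf_le)
      show "norm (exp (- y) ^ Suc j / real (Suc j) ^ 2) \<le> exp (- y) * (1 / real (Suc j) ^ 2)" for j
        using elim by (auto simp: divide_right_mono power_le_one mult_left_le simp del: of_nat_Suc)
    qed (intro summable_mult summable_inverse_squares)
    then show ?case
      by (simp only: suminf_mult[OF summable_inverse_squares] suminf_inverse_squares)
  qed
  show "((\<lambda>y. exp (- y) * (pi\<^sup>2 / 6)) \<longlongrightarrow> 0) at_top" by real_asymp
qed

text \<open>Termwise differentiation in \<open>q = exp (- y)\<close> gives
  \<open>- ln (1 - q) / q\<close>, and the inner derivative \<open>- q\<close> cancels the
  denominator.\<close>

lemma DERIV_dilog:
  assumes "y > 0"
  shows "(dilog has_real_derivative ln (1 - exp (- y))) (at y)"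
proof -
  define q where "q = exp (- y)"
  have q: "0 < q" "q < 1" using assms by (auto simp: q_def)
  have eq: "1 / real (Suc n) ^ 2 * real (Suc n) * x ^ n = x ^ n / real (Suc n)" for n x
    by (simp add: power2_eq_square del: of_nat_Suc)
  have s: "(\<lambda>n. x ^ n / real (Suc n)) sums (- ln (1 - x) / x)" if "0 < x" "x < 1" for x
    using sums_divide[OF sums_neg_ln_one_minus[of x], of x] that by simp
  have "DERIV (\<lambda>x. (\<Sum>n. 1 / real (Suc n) ^ 2 * x ^ Suc n)) q :> (\<Sum>n. 1 / real (Suc n) ^ 2 * real (Suc n) * q ^ n)"
  proof (rule DERIV_power_series'[where R = 1])
    fix x :: real assume "x \<in> {-1<..<1}"
    then have "summable (\<lambda>n. \<bar>x\<bar> ^ n)" by (intro summable_geometric) auto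
    then have "summable (\<lambda>n. x ^ n / real (Suc n))"
      by (rule summable_comparison_test'[where N = 0]) (auto simp: abs_mult power_abs divide_le_eq mult_le_cancel_left1)
    then show "summable (\<lambda>n. 1 / real (Suc n) ^ 2 * real (Suc n) * x ^ n)" by (simp only: eq)
  qed (use q in auto)
  also have "(\<Sum>n. 1 / real (Suc n) ^ 2 * real (Suc n) * q ^ n) = - ln (1 - q) / q"
    using s[OF q] by (simp only: eq sums_iff)
  finally have "((\<lambda>x. (\<Sum>n. 1 / real (Suc n) ^ 2 * x ^ Suc n)) has_real_derivative - ln (1 - q) / q) (at (exp (- y)))"
    by (simp only: q_def)
  moreover have "((\<lambda>y. exp (- y)) has_real_derivative - q) (at y)"
    unfolding q_def by (auto intro!: derivative_eq_intros)
  ultimately have "((\<lambda>y. (\<Sum>n. 1 / real (Suc n) ^ 2 * exp (- y) ^ Suc n)) has_real_derivative (- ln (1 - q) / q) * (- q)) (at y)"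
    by (rule DERIV_chain2)
  moreover have "(\<lambda>y. (\<Sum>n. 1 / real (Suc n) ^ 2 * exp (- y) ^ Suc n)) = dilog"
    by (rule ext) (simp add: dilog_def)
  ultimately show ?thesis using q by (simp add: q_def)
qed

section \<open>Trapezoid errors of exponentials and of the logarithm\<close>

lemma one_minus_exp_le: "1 - exp (- u) \<le> (u::real)"
  using exp_ge_add_one_self[of "- u"] by linarith

text \<open>The quadratic Taylor polynomials of \<open>exp u\<close> and \<open>exp (- u)\<close>
  multiply to \<open>1 + u^4 / 4\<close>, so the upper bound here follows from the lower bound for
  \<open>exp u\<close>.\<close>

lemma exp_neg_le_quadratic:
  assumes "(u::real) \<ge> 0"
  shows "exp (- u) \<le> 1 - u + u\<^sup>2 / 2"
proof -
  have "1 \<le> (1 + u + u\<^sup>2 / 2) * (1 - u + u\<^sup>2 / 2)"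
    using assms by (simp add: algebra_simps power2_eq_square)
  also have "\<dots> \<le> exp u * (1 - u + u\<^sup>2 / 2)"
  proof (rule mult_right_mono)
    have "0 \<le> (1 - u)\<^sup>2 + 1" by simp
    then show "0 \<le> 1 - u + u\<^sup>2 / 2" by (simp add: power2_eq_square algebra_simps)
  qed (use exp_lower_Taylor_quadratic[OF assms] in simp)
  finally show ?thesis by (simp add: exp_minus field_simps)
qed

text \<open>The difference is the error of the trapezoid rule for \<open>exp (- u * t)\<close> with
  \<open>t\<close> in \<open>[0, 1]\<close>. It is nonnegative by convexity, and quadratic Taylor
  bounds limit it from above.\<close>

lemma trapezoid_exp_bounds:
  assumes "(u::real) > 0"
  shows "\<bar>(1 + exp (- u)) / 2 - (1 - exp (- u)) / u\<bar> \<le> u\<^sup>2 / 4"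
proof -
  have 1: "u - u\<^sup>2 / 2 \<le> 1 - exp (- u)" using exp_neg_le_quadratic[of u] assms by simp
  have "1 - u / 2 \<le> (1 - exp (- u)) / u"
    using divide_right_mono[OF 1, of u] assms by (simp add: diff_divide_distrib power2_eq_square)
  moreover have step: "(1 + e) / 2 - w \<le> u\<^sup>2 / 4" if "1 - u / 2 \<le> w" "e \<le> 1 - u + u\<^sup>2 / 2" for e w :: real
    using that by (simp add: add_divide_distrib)
  ultimately have U: "(1 + exp (- u)) / 2 - (1 - exp (- u)) / u \<le> u\<^sup>2 / 4"
    using exp_neg_le_quadratic[OF less_imp_le[OF assms]] by (intro step)
  \<comment> \<open>\<open>k u\<close> is the error multiplied by \<open>2 * u\<close>, and
    \<open>k 0 = 0\<close>.\<close>
  define k where "k = (\<lambda>t::real. exp (- t) * (t + 2) + t - 2)"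
  have "k 0 \<le> k u"
  proof (rule DERIV_nonneg_imp_nondecreasing[of 0 u k])
    fix t :: real assume t: "0 \<le> t" "t \<le> u"
    have "(k has_real_derivative 1 - exp (- t) * (1 + t)) (at t)"
      unfolding k_def by (auto intro!: derivative_eq_intros simp: algebra_simps)
    moreover have "exp (- t) * (1 + t) \<le> 1"
      using exp_ge_add_one_self[of t] by (simp add: exp_minus field_simps)
    ultimately show "\<exists>y. (k has_real_derivative y) (at t) \<and> 0 \<le> y" by (intro exI[of _ "1 - exp (- t) * (1 + t)"]) auto
  qed (use assms in simp)
  then have "0 \<le> (1 + exp (- u)) / 2 - (1 - exp (- u)) / u"
    using assms by (simp add: k_def field_simps)
  with U show ?thesis by simp
qed

text \<open>This is \<open>u / 2 \<le> sinh (u / 2)\<close> multiplied by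
  \<open>2 * exp (- u / 2)\<close>. Its square yields \<open>geometric_moment1_bound\<close> with
  constant exactly 1, as \<open>moment1_approx\<close> requires.\<close>

lemma le_exp_minus_exp:
  assumes "(u::real) \<ge> 0"
  shows "u * exp (- u / 2) \<le> 1 - exp (- u)"
proof -
  have "u \<le> exp (u / 2) - exp (- (u / 2))"
    using real_le_x_sinh[of "u / 2"] assms by (simp add: exp_minus)
  then have "u * exp (- (u / 2)) \<le> (exp (u / 2) - exp (- (u / 2))) * exp (- (u / 2))"
    by (intro mult_right_mono) auto
  also have "\<dots> = 1 - exp (- u)" by (simp add: algebra_simps flip: exp_add)
  finally show ?thesis by simp
qed

lemma geometric_moment1:
  fixes q :: "'a::{real_normed_field,banach}"
  assumes "norm q < 1"
  shows "(\<lambda>j. of_nat (Suc j) * q ^ Suc j) sums (q / (1 - q)\<^sup>2)"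
  using sums_mult2[OF geometric_deriv_sums[OF assms], of q] by (simp add: mult_ac)

lemma geometric_moment1_bound:
  assumes "(u::real) > 0"
  shows "exp (- u) / (1 - exp (- u))\<^sup>2 \<le> 1 / u\<^sup>2"
proof -
  have "(u * exp (- u / 2))\<^sup>2 \<le> (1 - exp (- u))\<^sup>2"
    using le_exp_minus_exp[of u] assms by (intro power_mono) auto
  then have "u\<^sup>2 * exp (- u) \<le> (1 - exp (- u))\<^sup>2"
    by (simp add: power_mult_distrib flip: exp_of_nat_mult)
  with assms show ?thesis by (simp add: divide_simps mult_ac)
qed

text \<open>The error of the trapezoid rule for \<open>y \<mapsto> - ln (1 - exp (- y))\<close> on \<open>[n * x, (n + 1) * x]\<close>, in units of
  \<open>x\<close>. As \<open>x \<rightarrow> 0\<close> it converges to the same error for \<open>- ln\<close> on \<open>[n, n + 1]\<close>, and the sum of the latter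
  is given by Stirling's formula.\<close>

definition trap :: "real \<Rightarrow> nat \<Rightarrow> real" where
  "trap x n = (- ln (1 - exp (- (real n * x))) - ln (1 - exp (- (real (Suc n) * x)))) / 2
     - (dilog (real n * x) - dilog (real (Suc n) * x)) / x"

text \<open>Expanded in powers of \<open>q = exp (- n * x)\<close>, the error is a combination of
  the trapezoid errors of exponentials. Bounding these leaves \<open>x^2 / 4\<close> times the first
  moment of the geometric series, which is at most \<open>1 / (n * x)^2\<close>. The powers of
  \<open>x\<close> cancel, so the bound is uniform in \<open>x\<close>, as Tannery's theorem
  needs.\<close>

lemma norm_trap_le:
  assumes x: "x > 0" and n: "n > 0"
  shows "norm (trap x n) \<le> 1 / (4 * real n ^ 2)"
proof -
  define q where "q = exp (- (real n * x))"
  have q: "0 < q" "q < 1" using assms by (auto simp: q_def)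
  define b where "b = (\<lambda>u::real. (1 + exp (- u)) / 2 - (1 - exp (- u)) / u)"
  have S: "(\<lambda>j. q ^ Suc j / real (Suc j) * b (real (Suc j) * x)) sums trap x n"
  proof -
    define q' where "q' = exp (- (real (Suc n) * x))"
    have q': "0 < q'" "q' < 1" using assms by (auto simp: q'_def)
    have "(\<lambda>j. (q ^ Suc j / real (Suc j) + q' ^ Suc j / real (Suc j)) / 2
        - (q ^ Suc j / real (Suc j) ^ 2 - q' ^ Suc j / real (Suc j) ^ 2) / x) sums
       ((- ln (1 - q) + - ln (1 - q')) / 2 - (dilog (real n * x) - dilog (real (Suc n) * x)) / x)"
      unfolding dilog_def q_def[symmetric] q'_def[symmetric]
      using summable_dilog[of "real n * x"] summable_dilog[of "real (Suc n) * x"] assms q q'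
      by (intro sums_diff sums_add sums_divide sums_neg_ln_one_minus summable_sums)
         (auto simp: q_def q'_def simp del: power_Suc of_nat_Suc)
    moreover have "(q ^ Suc j / real (Suc j) + q' ^ Suc j / real (Suc j)) / 2
        - (q ^ Suc j / real (Suc j) ^ 2 - q' ^ Suc j / real (Suc j) ^ 2) / x
        = q ^ Suc j / real (Suc j) * b (real (Suc j) * x)" for j
    proof -
      have "q' ^ Suc j = q ^ Suc j * exp (- (real (Suc j) * x))"
        unfolding q'_def q_def exp_of_nat_mult[symmetric] exp_add[symmetric] by (simp add: algebra_simps)
      with x show ?thesis
        unfolding b_def by (simp add: field_simps power2_eq_square del: power_Suc of_nat_Suc)
    qed
    ultimately show ?thesis
      by (simp add: trap_def q_def q'_def del: power_Suc of_nat_Suc)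
  qed
  have "norm q < 1" using q by simp
  note M = sums_mult[OF geometric_moment1[OF this], of "x\<^sup>2 / 4"]
  have B: "norm (q ^ Suc j / real (Suc j) * b (real (Suc j) * x)) \<le> x\<^sup>2 / 4 * (real (Suc j) * q ^ Suc j)" for j
  proof -
    have "norm (q ^ Suc j / real (Suc j) * b (real (Suc j) * x)) \<le> q ^ Suc j / real (Suc j) * ((real (Suc j) * x)\<^sup>2 / 4)"
      using q x trapezoid_exp_bounds[of "real (Suc j) * x"] unfolding b_def norm_mult real_norm_def abs_mult
      by (intro mult_mono) (auto simp del: power_Suc of_nat_Suc)
    also have "\<dots> = x\<^sup>2 / 4 * (real (Suc j) * q ^ Suc j)"
      by (simp add: field_simps power2_eq_square del: power_Suc of_nat_Suc)
    finally show ?thesis .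
  qed
  have "norm (trap x n) \<le> x\<^sup>2 / 4 * (q / (1 - q)\<^sup>2)"
    using norm_suminf_le[of _ "\<lambda>j. x\<^sup>2 / 4 * (real (Suc j) * q ^ Suc j)", OF B] S M by (simp only: sums_iff)
  also have "\<dots> \<le> x\<^sup>2 / 4 * (1 / (real n * x)\<^sup>2)"
    unfolding q_def using x n by (intro mult_left_mono geometric_moment1_bound) auto
  also have "\<dots> = 1 / (4 * real n ^ 2)"
    using x by (simp add: power_mult_distrib)
  finally show ?thesis .
qed

text \<open>The interval \<open>[0, x]\<close> is left out because the logarithm is infinite at
  \<open>0\<close>; by the convention \<open>ln 0 = 0\<close>, \<open>trap x 0\<close> would not be
  a trapezoid error. In the sum \<open>dilog\<close> telescopes and every inner node receives weight
  1/2 twice.\<close>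

lemma trap_sums:
  assumes x: "x > 0"
  shows "(\<lambda>n. trap x (Suc n)) sums (plog (exp (- x)) + ln (1 - exp (- x)) / 2 - dilog x / x)"
proof -
  define g where "g = (\<lambda>y::real. - ln (1 - exp (- y)))"
  have fl: "filterlim (\<lambda>N. real (Suc (Suc N)) * x) at_top sequentially"
    using x by real_asymp
  have eq: "(\<Sum>n\<le>N. trap x (Suc n)) = (\<Sum>n\<le>N. g (real (Suc n) * x)) - g x / 2 + g (real (Suc (Suc N)) * x) / 2
      - (dilog x - dilog (real (Suc (Suc N)) * x)) / x" for N
  proof (induction N)
    case 0
    then show ?case by (simp add: trap_def g_def field_simps)
  next
    case (Suc N)
    have t: "trap x (Suc (Suc N)) = (g (real (Suc (Suc N)) * x) + g (real (Suc (Suc (Suc N))) * x)) / 2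
      - (dilog (real (Suc (Suc N)) * x) - dilog (real (Suc (Suc (Suc N))) * x)) / x"
      by (simp add: trap_def g_def del: of_nat_Suc)
    show ?case unfolding sum.atMost_Suc Suc.IH t
      by (simp add: add_divide_distrib diff_divide_distrib del: of_nat_Suc)
  qed
  have "exp (- x) < 1" using x by simp
  then have "(\<lambda>N. \<Sum>n\<le>N. - ln (1 - exp (- x) ^ Suc n)) \<longlonglongrightarrow> plog (exp (- x))"
    using sums_neg_ln_plog[of "exp (- x)"] by (simp only: sums_def_le) simp
  moreover have "exp (- x) ^ Suc n = exp (- (real (Suc n) * x))" for n
    by (simp only: exp_of_nat_mult[symmetric]) simp
  ultimately have 1: "(\<lambda>N. \<Sum>n\<le>N. g (real (Suc n) * x)) \<longlonglongrightarrow> plog (exp (- x))"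
    by (simp only: g_def)
  have "(g \<longlongrightarrow> 0) at_top" unfolding g_def by real_asymp
  then have 2: "(\<lambda>N. g (real (Suc (Suc N)) * x)) \<longlonglongrightarrow> 0"
    using fl by (rule filterlim_compose)
  have 3: "(\<lambda>N. dilog (real (Suc (Suc N)) * x)) \<longlonglongrightarrow> 0"
    using dilog_tendsto_0 fl by (rule filterlim_compose)
  have "(\<lambda>N. \<Sum>n\<le>N. trap x (Suc n)) \<longlonglongrightarrow> plog (exp (- x)) - g x / 2 + 0 / 2 - (dilog x - 0) / x"
    unfolding eq using x by (intro tendsto_intros 1 2 3) auto
  then show ?thesis by (simp add: sums_def_le g_def)
qed

text \<open>The quotient is the mean of \<open>exp (- s)\<close> over
  \<open>0 \<le> s \<le> y\<close>, hence lies between \<open>exp (- y)\<close> and 1.\<close>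

lemma ln_one_minus_exp_over_bounds:
  assumes "(y::real) > 0"
  shows "ln ((1 - exp (- y)) / y) \<in> {- y..0}"
proof -
  have "1 - exp (- y) > 0" using assms by simp
  moreover have "exp (- y) \<le> (1 - exp (- y)) / y"
    using exp_ge_add_one_self[of y] assms by (simp add: exp_minus field_simps)
  then have "ln (exp (- y)) \<le> ln ((1 - exp (- y)) / y)" by (intro ln_mono) auto
  moreover have "(1 - exp (- y)) / y \<le> 1" using one_minus_exp_le[of y] assms by simp
  ultimately show ?thesis using assms by simp
qed

lemma continuous_on_x_ln_x: "continuous_on {0..} (\<lambda>s::real. s * ln s)"
  unfolding continuous_on_eq_continuous_within
proof
  fix s :: real assume "s \<in> {0..}"
  show "continuous (at s within {0..}) (\<lambda>s. s * ln s)"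
  proof (cases "s = 0")
    case True
    have "((\<lambda>s::real. s * ln s) \<longlongrightarrow> 0) (at_right 0)" by real_asymp
    then show ?thesis using True by (simp add: continuous_within at_within_Ici_at_right)
  next
    case False
    then show ?thesis by (auto intro!: continuous_intros)
  qed
qed

text \<open>As a function of \<open>s\<close>, \<open>dilog (s * x) / x\<close> has derivative
  \<open>ln (1 - exp (- s * x))\<close>, close to \<open>ln s + ln x\<close>. \<open>W\<close>
  subtracts the antiderivative of the latter, so its derivative is the small logarithm of
  \<open>ln_one_minus_exp_over_bounds\<close>.\<close>

lemma dilog_increment_bound:
  assumes x: "x > 0" and ab: "0 \<le> a" "a < b"
  shows "\<bar>(dilog (b * x) - dilog (a * x)) / x - (b * ln b - b - (a * ln a - a)) - (b - a) * ln x\<bar> \<le> (b - a) * (b * x)"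
proof -
  define W where "W = (\<lambda>s. dilog (s * x) / x - (s * ln s - s) - s * ln x)"
  have "continuous_on {a..b} W"
    unfolding W_def
    by (intro continuous_intros continuous_on_compose2[OF continuous_on_dilog]
         continuous_on_subset[OF continuous_on_x_ln_x])
       (use x ab in auto)
  moreover have D: "(W has_real_derivative ln ((1 - exp (- (s * x))) / (s * x))) (at s)" if "s > a" for s
  proof -
    have s: "s > 0" "s * x > 0" "exp (- (s * x)) < 1" using that ab x by auto
    then have "ln ((1 - exp (- (s * x))) / (s * x)) = ln (1 - exp (- (s * x))) - ln s - ln x"
      using x by (simp add: ln_div ln_mult)
    then show ?thesis
      unfolding W_def using s x
      by (auto intro!: derivative_eq_intros DERIV_chain2[OF DERIV_dilog])
  qed
  ultimately obtain l z where z: "a < z" "z < b" and l: "(W has_real_derivative l) (at z)" "W b - W a = (b - a) * l"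
    using MVT[of a b W] ab by (metis real_differentiable_def)
  have "l = ln ((1 - exp (- (z * x))) / (z * x))" using l(1) D[OF z(1)] by (rule DERIV_unique)
  moreover have "ln ((1 - exp (- (z * x))) / (z * x)) \<in> {- (z * x)..0}"
    using z ab x by (intro ln_one_minus_exp_over_bounds) auto
  ultimately have "\<bar>l\<bar> \<le> z * x" by auto
  also have "\<dots> \<le> b * x" using z x by simp
  finally have "\<bar>W b - W a\<bar> \<le> (b - a) * (b * x)"
    using l(2) ab by (simp add: abs_mult)
  moreover have "W b - W a = (dilog (b * x) - dilog (a * x)) / x - (b * ln b - b - (a * ln a - a)) - (b - a) * ln x"
    by (simp add: W_def algebra_simps diff_divide_distrib)
  ultimately show ?thesis by simp
qed

lemma dilog_increment_tendsto:
  assumes ab: "0 \<le> a" "a < b"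
  shows "((\<lambda>x. (dilog (b * x) - dilog (a * x)) / x - (b - a) * ln x) \<longlongrightarrow> b * ln b - b - (a * ln a - a)) (at_right 0)"
proof -
  have "((\<lambda>x. (dilog (b * x) - dilog (a * x)) / x - (b - a) * ln x - (b * ln b - b - (a * ln a - a))) \<longlongrightarrow> 0) (at_right 0)"
  proof (rule Lim_null_comparison)
    show "\<forall>\<^sub>F x in at_right 0. norm ((dilog (b * x) - dilog (a * x)) / x - (b - a) * ln x - (b * ln b - b - (a * ln a - a))) \<le> (b - a) * (b * x)"
      using eventually_at_right_less
    proof eventually_elim
      case (elim x)
      show ?case using dilog_increment_bound[OF elim ab] by (simp add: algebra_simps)
    qed
  qed (auto intro!: tendsto_eq_intros)
  then show ?thesis by (simp only: LIM_zero_iff)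
qed

lemma ln_one_minus_exp_tendsto:
  fixes c :: real
  assumes "c > 0"
  shows "((\<lambda>x. ln (1 - exp (- (c * x))) - ln x) \<longlongrightarrow> ln c) (at_right 0)"
proof -
  have "((\<lambda>x. ln ((1 - exp (- (c * x))) / (c * x))) \<longlongrightarrow> 0) (at_right 0)"
  proof (rule Lim_null_comparison)
    show "\<forall>\<^sub>F x in at_right 0. norm (ln ((1 - exp (- (c * x))) / (c * x))) \<le> c * x"
      using eventually_at_right_less
    proof eventually_elim
      case (elim x)
      then show ?case using ln_one_minus_exp_over_bounds[of "c * x"] assms by auto
    qed
  qed (auto intro!: tendsto_eq_intros)
  then have "((\<lambda>x. ln ((1 - exp (- (c * x))) / (c * x)) + ln c) \<longlongrightarrow> 0 + ln c) (at_right 0)"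
    by (intro tendsto_intros)
  moreover have "\<forall>\<^sub>F x in at_right 0. ln ((1 - exp (- (c * x))) / (c * x)) + ln c = ln (1 - exp (- (c * x))) - ln x"
    using eventually_at_right_less
  proof eventually_elim
    case (elim x)
    then have "exp (- (c * x)) < 1" using assms by simp
    with elim assms show ?case by (simp add: ln_div ln_mult)
  qed
  ultimately show ?thesis by (simp add: tendsto_cong)
qed

section \<open>Stirling's constant from the trapezoid errors\<close>

definition trap_ln :: "nat \<Rightarrow> real" where
  "trap_ln n = - (ln (real n) + ln (real (Suc n))) / 2
     + (real (Suc n) * ln (real (Suc n)) - real (Suc n) - (real n * ln (real n) - real n))"

text \<open>The average of the endpoint values and the mean over the interval each contain
  \<open>ln x\<close> exactly once, so the divergent parts cancel.\<close>

lemma trap_tendsto: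
  assumes "n > 0"
  shows "((\<lambda>x. trap x n) \<longlongrightarrow> trap_ln n) (at_right 0)"
proof -
  let ?g = "\<lambda>c x. ln (1 - exp (- (c * x))) - ln x"
  let ?d = "\<lambda>x. (dilog (real (Suc n) * x) - dilog (real n * x)) / x - (real (Suc n) - real n) * ln x"
  have "((\<lambda>x. - (?g (real n) x + ?g (real (Suc n)) x) / 2 + ?d x) \<longlongrightarrow> trap_ln n) (at_right 0)"
    unfolding trap_ln_def using assms
    by (intro tendsto_intros ln_one_minus_exp_tendsto dilog_increment_tendsto) auto
  moreover have "- (?g (real n) x + ?g (real (Suc n)) x) / 2 + ?d x = trap x n" for x
    by (simp add: trap_def field_simps) (simp add: add_divide_distrib diff_divide_distrib)
  ultimately show ?thesis by simp
qed

text \<open>The majorant of \<open>norm_trap_le\<close> does not depend on \<open>x\<close>, and the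
  limits of the terms inherit it; Tannery's theorem therefore delivers both claims.\<close>

lemma
  shows summable_trap_ln: "summable (\<lambda>n. trap_ln (Suc n))"
    and suminf_trap_tendsto: "((\<lambda>x. \<Sum>n. trap x (Suc n)) \<longlongrightarrow> (\<Sum>n. trap_ln (Suc n))) (at_right 0)"
proof -
  have "summable (\<lambda>n. 1 / 4 * (1 / real (Suc n) ^ 2))"
    by (intro summable_mult summable_inverse_squares)
  moreover have "\<forall>\<^sub>F (k, x) in at_top \<times>\<^sub>F at_right 0. norm (trap x (Suc k)) \<le> 1 / 4 * (1 / real (Suc k) ^ 2)"
    unfolding eventually_prod_filter
    by (rule exI[of _ "\<lambda>_. True"], rule exI[of _ "\<lambda>x. x > 0"])
       (use norm_trap_le in \<open>auto intro: eventually_at_right_less simp del: of_nat_Suc\<close>)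
  ultimately have *: "summable (\<lambda>n. norm (trap_ln (Suc n))) \<and>
      ((\<lambda>x. \<Sum>n. trap x (Suc n)) \<longlongrightarrow> (\<Sum>n. trap_ln (Suc n))) (at_right 0)"
    using tannerys_theorem[of "\<lambda>n x. trap x (Suc n)" "\<lambda>n. trap_ln (Suc n)" "at_right 0" "\<lambda>n. 1 / 4 * (1 / real (Suc n) ^ 2)"]
      trap_tendsto by auto
  then show "summable (\<lambda>n. trap_ln (Suc n))" by (blast intro: summable_norm_cancel)
  from * show "((\<lambda>x. \<Sum>n. trap x (Suc n)) \<longlongrightarrow> (\<Sum>n. trap_ln (Suc n))) (at_right 0)" by blast
qed

text \<open>The right side is 1 minus the Stirling error
  \<open>ln (fact n) - (n + 1 / 2) * ln n + n\<close> at \<open>n = Suc N\<close>, so the infinite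
  sum encodes Stirling's constant.\<close>

lemma sum_trap_ln: "(\<Sum>n<N. trap_ln (Suc n)) = - ln (fact (Suc N)) + (real (Suc N) + 1 / 2) * ln (real (Suc N)) - real N"
proof (induction N)
  case (Suc N)
  have "ln (fact (Suc (Suc N)) :: real) = ln (real (Suc (Suc N))) + ln (fact (Suc N))"
    unfolding fact_Suc[of "Suc N"] by (subst ln_mult) (auto simp del: fact_Suc)
  with Suc.IH show ?case
    unfolding sum.lessThan_Suc trap_ln_def
    by (simp add: algebra_simps add_divide_distrib diff_divide_distrib del: fact_Suc)
qed simp

text \<open>The odd numbers up to \<open>2 * n - 1\<close> multiply to
  \<open>fact (2 * n) / (2 ^ n * fact n)\<close>. They occur twice in the denominator, together with
  one factor \<open>2 * n + 1\<close>.\<close>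

lemma wallis_prod_eq: "(\<Prod>k=1..n. (4*real k^2) / (4*real k^2 - 1)) = (2 ^ n * fact n) ^ 4 / ((fact (2 * n))\<^sup>2 * (2 * real n + 1))"
proof (induction n)
  case (Suc n)
  have 1: "(4*real (Suc n)^2 - 1) = (2 * real n + 1) * (2 * real n + 3)"
    by (simp add: power2_eq_square algebra_simps)
  have 2: "(fact (2 * Suc n) :: real) = (2 * real n + 2) * (2 * real n + 1) * fact (2 * n)"
    by (simp add: algebra_simps)
  have 3: "(\<Prod>k=1..Suc n. (4*real k^2) / (4*real k^2 - 1)) = 
     (\<Prod>k=1..n. (4*real k^2) / (4*real k^2 - 1)) * ((4*real (Suc n)^2) / (4*real (Suc n)^2 - 1))"
    by simp
  define a b f h where "a = 2 * real n + 1" and "b = real n + 1" and "f = (fact (2 * n) :: real)" and "h = (2 ^ n * fact n :: real)"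
  have nz: "a \<noteq> 0" "b \<noteq> 0" "f \<noteq> 0" "a + 2 \<noteq> 0" by (auto simp: a_def b_def f_def)
  have "(\<Prod>k=1..Suc n. (4*real k^2) / (4*real k^2 - 1)) = h ^ 4 / (f\<^sup>2 * a) * (4 * b\<^sup>2 / (a * (a + 2)))"
    unfolding 3 1 Suc.IH by (simp add: a_def b_def f_def h_def add.commute)
  also have "\<dots> = (2 * b * h) ^ 4 / ((2 * b * a * f)\<^sup>2 * (a + 2))"
  proof -
    have "h ^ 4 * (4 * b\<^sup>2) * ((2 * b * a * f)\<^sup>2 * (a + 2)) = (2 * b * h) ^ 4 * (f\<^sup>2 * a * (a * (a + 2)))"
      by (simp add: power_mult_distrib power2_eq_square power4_eq_xxxx mult_ac)
    then show ?thesis using nz by (simp add: frac_eq_eq)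
  qed
  also have "2 * b * h = 2 ^ Suc n * fact (Suc n)" by (simp add: b_def h_def)
  also have "2 * b * a * f = fact (2 * Suc n)" unfolding 2 by (simp add: a_def b_def f_def)
  also have "a + 2 = 2 * real (Suc n) + 1" by (simp add: a_def)
  finally show ?case .
qed simp

lemma suminf_trap_ln: "(\<Sum>n. trap_ln (Suc n)) = 1 - ln (2 * pi) / 2"
proof -
  define S where "S = (\<Sum>n. trap_ln (Suc n))"
  define r where "r = (\<lambda>n. ln (fact n) - (real n + 1 / 2) * ln (real n) + real n)"
  have "(\<lambda>N. \<Sum>n<N. trap_ln (Suc n)) \<longlonglongrightarrow> S"
    using summable_sums[OF summable_trap_ln] by (simp add: S_def sums_def)
  then have "(\<lambda>N. 1 - (\<Sum>n<N. trap_ln (Suc n))) \<longlonglongrightarrow> 1 - S"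
    by (intro tendsto_intros)
  then have "(\<lambda>N. r (Suc N)) \<longlonglongrightarrow> 1 - S"
    unfolding sum_trap_ln r_def by (simp add: algebra_simps)
  then have r: "r \<longlonglongrightarrow> 1 - S" by (rule LIMSEQ_imp_Suc)
  have fl: "filterlim (\<lambda>n::nat. 2 * n) at_top sequentially"
    by (rule filterlim_subseq) (auto simp: strict_mono_def)
  have r2: "(\<lambda>n. r (2 * n)) \<longlonglongrightarrow> 1 - S" by (rule filterlim_compose[OF r fl])
  \<comment> \<open>\<open>4 * r n - 2 * r (2 * n)\<close> reproduces the factorials in the
    logarithm of the Wallis product. Both copies of \<open>r\<close> have the same limit, so that
    \<open>2 * (1 - S) - 2 * ln 2 = ln (pi / 2)\<close>.\<close>
  have lim: "(\<lambda>n. 4 * r n - 2 * r (2 * n) + (2 * ln (real n) - ln (2 * real n) - ln (2 * real n + 1)))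
     \<longlonglongrightarrow> 4 * (1 - S) - 2 * (1 - S) + (- 2 * ln 2)"
  proof (intro tendsto_intros r r2)
    show "(\<lambda>n. 2 * ln (real n) - ln (2 * real n) - ln (2 * real n + 1)) \<longlonglongrightarrow> (- 2 * ln 2)"
      by real_asymp
  qed
  have "(\<lambda>n. ln (\<Prod>k=1..n. (4*real k^2) / (4*real k^2 - 1))) \<longlonglongrightarrow> ln (pi / 2)"
    by (intro tendsto_ln wallis) auto
  moreover have "\<forall>\<^sub>F n in sequentially. ln (\<Prod>k=1..n. (4*real k^2) / (4*real k^2 - 1)) =
     4 * r n - 2 * r (2 * n) + (2 * ln (real n) - ln (2 * real n) - ln (2 * real n + 1))"
    using eventually_gt_at_top[of 0]
  proof eventually_elim
    case (elim n)
    have h1: "ln (\<Prod>k=1..n. (4*real k^2) / (4*real k^2 - 1)) = 4 * (real n * ln 2 + ln (fact n)) - (2 * ln (fact (2 * n)) + ln (2 * real n + 1))"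
    proof -
      have ln_quot: "ln (X ^ 4 / (Y\<^sup>2 * Z)) = 4 * ln X - (2 * ln Y + ln Z)" if "X > 0" "Y > 0" "Z > 0" for X Y Z :: real
        using that by (simp add: ln_div ln_mult ln_realpow)
      show ?thesis
        unfolding wallis_prod_eq by (subst ln_quot) (auto simp: ln_mult_pos ln_realpow)
    qed
    have h2: "ln (2 * real n) = ln 2 + ln (real n)"
      using elim by (simp add: ln_mult)
    have h3: "4 * (F - (m + 1 / 2) * a + m) - 2 * (G - (2 * m + 1 / 2) * (l + a) + 2 * m) + (2 * a - (l + a) - z)
        = 4 * (m * l + F) - (2 * G + z)" for F G m a l z :: real
      by (simp add: field_simps)
    show ?case
      unfolding r_def of_nat_mult of_nat_numeral h1 h2 by (rule h3[symmetric])
  qed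
  ultimately have "(\<lambda>n. 4 * r n - 2 * r (2 * n) + (2 * ln (real n) - ln (2 * real n) - ln (2 * real n + 1)))
      \<longlonglongrightarrow> ln (pi / 2)"
    by (rule Lim_transform_eventually)
  then have "4 * (1 - S) - 2 * (1 - S) + (- 2 * ln 2) = ln (pi / 2)"
    by (rule LIMSEQ_unique[OF lim])
  then show ?thesis by (simp add: S_def ln_div ln_mult field_simps)
qed

text \<open>Solve \<open>trap_sums\<close> for \<open>plog\<close>. The sum tends to
  \<open>1 - ln (2 * pi) / 2\<close>, the half weight at the first node contributes
  \<open>- ln x / 2\<close>, and the integral over \<open>[0, x]\<close> gives
  \<open>dilog x / x\<close>, which is \<open>pi^2 / (6 * x) + ln x - 1\<close> up to a vanishing
  error.\<close>

lemma plog_exp_asymp: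
  "((\<lambda>x. plog (exp (- x)) - pi\<^sup>2 / (6 * x) - ln (x / (2 * pi)) / 2) \<longlongrightarrow> 0) (at_right 0)"
proof -
  let ?T = "\<lambda>x. \<Sum>n. trap x (Suc n)"
  let ?d = "\<lambda>x. (dilog (1 * x) - dilog (0 * x)) / x - (1 - 0) * ln x"
  let ?g = "\<lambda>x. ln (1 - exp (- (1 * x))) - ln x"
  have "((\<lambda>x. ?T x - ?g x / 2 + ?d x + ln (2 * pi) / 2) \<longlongrightarrow> (1 - ln (2 * pi) / 2) - ln 1 / 2 + (1 * ln 1 - 1 - (0 * ln 0 - 0)) + ln (2 * pi) / 2) (at_right 0)"
    unfolding suminf_trap_ln[symmetric]
    by (intro tendsto_intros suminf_trap_tendsto dilog_increment_tendsto ln_one_minus_exp_tendsto) auto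
  then have "((\<lambda>x. ?T x - ?g x / 2 + ?d x + ln (2 * pi) / 2) \<longlongrightarrow> 0) (at_right 0)" by simp
  moreover have "\<forall>\<^sub>F x in at_right 0. ?T x - ?g x / 2 + ?d x + ln (2 * pi) / 2 = plog (exp (- x)) - pi\<^sup>2 / (6 * x) - ln (x / (2 * pi)) / 2"
    using eventually_at_right_less
  proof eventually_elim
    case (elim x)
    have "?T x = plog (exp (- x)) + ln (1 - exp (- x)) / 2 - dilog x / x"
      using trap_sums[OF elim] by (simp add: sums_iff)
    with elim show ?case
      by (simp add: dilog_0 ln_div diff_divide_distrib add_divide_distrib)
  qed
  ultimately show ?thesis by (simp only: tendsto_cong)
qed

section \<open>Decay of the partition product away from the real axis\<close>

text \<open>With \<open>r = norm z\<close> and \<open>s = r - Re z\<close>, the square of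
  \<open>norm (1 - z)\<close> is \<open>(1 - r)^2 + 2 * s\<close>. As
  \<open>0 \<le> s \<le> 2\<close>, \<open>exp (s / 2) \<le> 1 + 2 * s\<close>, and
  \<open>(1 - r)^2 \<le> 1\<close>. The loss is linear in \<open>z\<close>, so over all powers of
  \<open>z\<close> it will sum to geometric series; its constant only has to be positive.\<close>

lemma norm_inverse_one_minus_le:
  fixes z :: complex
  assumes "norm z < 1"
  shows "norm (1 / (1 - z)) \<le> 1 / (1 - norm z) * exp (- (norm z - Re z) / 4)"
proof -
  define r s where "r = norm z" and "s = norm z - Re z"
  have r: "0 \<le> r" "r < 1" using assms by (auto simp: r_def)
  have s: "0 \<le> s" "s \<le> 2" using assms abs_Re_le_cmod[of z] by (auto simp: s_def)
  have "(norm (1 - z))\<^sup>2 = (1 - r)\<^sup>2 + 2 * s"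
    unfolding r_def s_def cmod_power2 by (simp add: power2_eq_square algebra_simps) 
       (simp add: cmod_power2 flip: power2_eq_square)
  moreover have "exp (s / 2) \<le> 1 + 2 * s"
    using exp_bound[of "s / 2"] s mult_mono[of s 2 s s] by (simp add: power2_eq_square)
  then have "(1 - r)\<^sup>2 * exp (s / 2) \<le> (1 - r)\<^sup>2 * (1 + 2 * s)"
    by (intro mult_left_mono) auto
  moreover have "(1 - r)\<^sup>2 * (2 * s) \<le> 1 * (2 * s)"
    using r s by (intro mult_right_mono power_le_one) auto
  ultimately have "(1 - r)\<^sup>2 * exp (s / 2) \<le> (norm (1 - z))\<^sup>2"
    by (simp add: algebra_simps)
  moreover have "(1 - r)\<^sup>2 * exp (s / 2) = ((1 - r) * exp (s / 4))\<^sup>2"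
    by (simp add: power_mult_distrib flip: exp_of_nat_mult)
  ultimately have le: "(1 - r) * exp (s / 4) \<le> norm (1 - z)"
    by (simp add: power2_le_iff_abs_le abs_mult r order_less_imp_le)
  have "0 < (1 - r) * exp (s / 4)" using r by simp
  then have "1 / norm (1 - z) \<le> 1 / ((1 - r) * exp (s / 4))"
    by (rule frac_le[OF zero_le_one order_refl _ le])
  also have "\<dots> = 1 / (1 - r) * exp (- s / 4)"
    using exp_minus[of "s / 4"] by (simp add: inverse_eq_divide)
  finally show ?thesis
    unfolding r_def s_def by (simp add: norm_divide)
qed

text \<open>Apply \<open>norm_inverse_one_minus_le\<close> to every factor of the product; the
  losses \<open>norm z ^ n - Re (z ^ n)\<close> add up to the difference of two geometric
  series.\<close>

lemma norm_exp_plog_le: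
  fixes z :: complex
  assumes z: "norm z < 1"
  shows "norm (exp (plog z)) \<le> exp (plog (norm z)) * exp (- (norm z / (1 - norm z) - Re (z / (1 - z))) / 4)"
proof -
  have z': "norm (z ^ Suc n) < 1" for n
    using z power_less_one_iff[of "norm z" "Suc n"] by (simp add: norm_power del: power_Suc)
  have geo: "(\<lambda>n. w ^ Suc n) sums (w / (1 - w))" if "norm w < 1" for w :: "'a::{real_normed_field,banach}"
    using sums_mult[OF geometric_sums[OF that], of w] by simp
  define a where "a = (\<lambda>n. norm z ^ Suc n - Re (z ^ Suc n))"
  have a: "a sums (norm z / (1 - norm z) - Re (z / (1 - z)))"
    unfolding a_def using z by (intro sums_diff sums_Re geo) auto
  have L: "(\<lambda>K. \<Sum>n\<le>K. a n) \<longlonglongrightarrow> (norm z / (1 - norm z) - Re (z / (1 - z)))"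
    using a by (simp only: sums_def_le)
  have P: "(\<lambda>K. \<Prod>n\<le>K. 1 / (1 - norm z ^ Suc n)) \<longlonglongrightarrow> exp (plog (norm z))"
  proof -
    have "(\<lambda>K. complex_of_real (\<Prod>n\<le>K. 1 / (1 - norm z ^ Suc n))) \<longlonglongrightarrow> of_real (exp (plog (norm z)))"
      using prod_tendsto_exp_plog[of "of_real (norm z)"] z by (simp add: plog_of_real exp_of_real)
    then show ?thesis by (simp only: tendsto_of_real_iff)
  qed
  show ?thesis
  proof (rule LIMSEQ_le)
    show "(\<lambda>K. norm (\<Prod>n\<le>K. 1 / (1 - z ^ Suc n))) \<longlonglongrightarrow> norm (exp (plog z))"
      by (intro tendsto_norm prod_tendsto_exp_plog z)
    show "(\<lambda>K. (\<Prod>n\<le>K. 1 / (1 - norm z ^ Suc n)) * exp (- (\<Sum>n\<le>K. a n) / 4)) \<longlonglongrightarrow>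
        exp (plog (norm z)) * exp (- (norm z / (1 - norm z) - Re (z / (1 - z))) / 4)"
      by (intro tendsto_intros L P) auto
    have "norm (\<Prod>n\<le>K. 1 / (1 - z ^ Suc n)) \<le> (\<Prod>n\<le>K. 1 / (1 - norm z ^ Suc n)) * exp (- (\<Sum>n\<le>K. a n) / 4)" for K
    proof -
      have "norm (\<Prod>n\<le>K. 1 / (1 - z ^ Suc n)) \<le> (\<Prod>n\<le>K. 1 / (1 - norm z ^ Suc n) * exp (- a n / 4))"
        unfolding prod_norm[symmetric]
      proof (intro prod_mono conjI norm_ge_zero)
        fix n
        show "norm (1 / (1 - z ^ Suc n)) \<le> 1 / (1 - norm z ^ Suc n) * exp (- a n / 4)"
          using norm_inverse_one_minus_le[OF z'[of n]] unfolding a_def norm_power .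
      qed
      also have "\<dots> = (\<Prod>n\<le>K. 1 / (1 - norm z ^ Suc n)) * exp (- (\<Sum>n\<le>K. a n) / 4)"
        by (simp only: prod.distrib exp_sum[OF finite_atMost, symmetric] sum_divide_distrib[symmetric] sum_negf)
      finally show ?thesis .
    qed
    then show "\<exists>N. \<forall>K\<ge>N. norm (\<Prod>n\<le>K. 1 / (1 - z ^ Suc n)) \<le> (\<Prod>n\<le>K. 1 / (1 - norm z ^ Suc n)) * exp (- (\<Sum>n\<le>K. a n) / 4)"
      by blast
  qed
qed

lemma geometric_real_part_gap:
  fixes r \<phi> :: real
  assumes r: "0 \<le> r" "r < 1"
  shows "r / (1 - r) - Re (rcis r \<phi> / (1 - rcis r \<phi>)) = r * (1 + r) * (1 - cos \<phi>) / ((1 - r) * ((1 - r)\<^sup>2 + 2 * r * (1 - cos \<phi>)))"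
proof -
  define c s where "c = cos \<phi>" and "s = sin \<phi>"
  have cs: "s\<^sup>2 = 1 - c\<^sup>2" by (simp add: c_def s_def sin_squared_eq)
  have c: "c \<le> 1" by (simp add: c_def)
  define d where "d = (1 - r)\<^sup>2 + 2 * r * (1 - c)"
  have "(1 - r)\<^sup>2 > 0" using r by simp
  then have d: "d > 0" using r c by (simp add: d_def add_pos_nonneg)
  have "(1 - r * c)\<^sup>2 + (r * s)\<^sup>2 = 1 - 2 * r * c + r\<^sup>2 * (c\<^sup>2 + s\<^sup>2)"
    by (simp add: power2_eq_square algebra_simps)
  also have "\<dots> = d" using cs by (simp add: d_def power2_eq_square algebra_simps)
  finally have D: "(1 - r * c)\<^sup>2 + (r * s)\<^sup>2 = d" .
  have "Re (rcis r \<phi> / (1 - rcis r \<phi>)) = (r * c * (1 - r * c) - (r * s)\<^sup>2) / d"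
    by (simp add: Re_divide rcis_def D flip: c_def s_def) (simp add: power2_eq_square)
  also have "r * c * (1 - r * c) - (r * s)\<^sup>2 = r * c - r\<^sup>2"
  proof -
    have "r * c * (1 - r * c) - (r * s)\<^sup>2 = r * c - r\<^sup>2 * (c\<^sup>2 + s\<^sup>2)"
      by (simp add: power2_eq_square algebra_simps)
    then show ?thesis using cs by simp
  qed
  finally have "r / (1 - r) - Re (rcis r \<phi> / (1 - rcis r \<phi>)) = r / (1 - r) - (r * c - r\<^sup>2) / d" by simp
  also have "\<dots> = (r * d - (r * c - r\<^sup>2) * (1 - r)) / ((1 - r) * d)"
    using r d by (simp add: diff_frac_eq mult_ac)
  also have "r * d - (r * c - r\<^sup>2) * (1 - r) = r * (1 + r) * (1 - c)"
    by (simp add: d_def power2_eq_square algebra_simps)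
  finally show ?thesis by (simp add: d_def c_def)
qed

text \<open>As soon as \<open>1 - cos \<phi>\<close> is at least \<open>x^2\<close>, this lower
  bound is of order \<open>1 / x\<close>, the same order as the logarithm of the whole
  product.\<close>

lemma geometric_real_part_gap_ge:
  fixes x \<phi> :: real
  assumes x: "0 < x" "x \<le> 1 / 2"
  defines "r \<equiv> exp (- x)"
  shows "r / (1 - r) - Re (rcis r \<phi> / (1 - rcis r \<phi>)) \<ge> (1 - cos \<phi>) / (2 * x * (x\<^sup>2 + 2 * (1 - cos \<phi>)))"
proof -
  define w where "w = 1 - cos \<phi>"
  have w: "w \<ge> 0" by (simp add: w_def)
  have r: "1 / 2 \<le> r" "r < 1" "1 - r \<le> x" using x exp_ge_add_one_self[of "- x"] by (auto simp: r_def)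
  have "w / (2 * x * (x\<^sup>2 + 2 * w)) = (1 / 2 * 1 * w) / (x * (x\<^sup>2 + 2 * 1 * w))"
    by simp
  also have "\<dots> \<le> (r * (1 + r) * w) / ((1 - r) * ((1 - r)\<^sup>2 + 2 * r * w))"
  proof (rule frac_le)
    show "1 / 2 * 1 * w \<le> r * (1 + r) * w"
      using r w by (intro mult_right_mono mult_mono) auto
    have "(1 - r)\<^sup>2 \<le> x\<^sup>2" using r by (intro power_mono) auto
    moreover have "2 * r * w \<le> 2 * 1 * w" using r w by (intro mult_right_mono) auto
    moreover have pos: "(1 - r)\<^sup>2 > 0" "0 \<le> 2 * r * w" using r w by auto
    ultimately show "(1 - r) * ((1 - r)\<^sup>2 + 2 * r * w) \<le> x * (x\<^sup>2 + 2 * 1 * w)"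
      using r x by (intro mult_mono) linarith+
    show "0 < (1 - r) * ((1 - r)\<^sup>2 + 2 * r * w)"
      using r pos by (intro mult_pos_pos add_pos_nonneg) auto
    show "0 \<le> r * (1 + r) * w" using r w by simp
  qed
  finally show ?thesis
    using geometric_real_part_gap[of r \<phi>] r by (simp add: w_def)
qed

text \<open>Chord lengths turn multiplicativity of \<open>\<theta> \<mapsto> cis \<theta>\<close> into a triangle inequality, so that a
  Bezout combination of \<open>S\<close> bounds the chord at \<open>Gcd S\<close>.\<close>

lemma norm_one_minus_cis_mult_int: "norm (1 - cis (of_int n * t)) \<le> real_of_int \<bar>n\<bar> * norm (1 - cis t)"
proof -
  have nat: "norm (1 - cis (real n * t)) \<le> real n * norm (1 - cis t)" for n t
  proof (induction n)
    case (Suc n)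
    have "1 - cis (real (Suc n) * t) = (1 - cis t) + cis t * (1 - cis (real n * t))"
      by (simp add: algebra_simps cis_mult)
    then have "norm (1 - cis (real (Suc n) * t)) \<le> norm (1 - cis t) + norm (cis t * (1 - cis (real n * t)))"
      by (simp only: norm_triangle_ineq)
    then have "norm (1 - cis (real (Suc n) * t)) \<le> norm (1 - cis t) + norm (1 - cis (real n * t))"
      by (simp only: norm_mult norm_cis mult_1)
    also have "\<dots> \<le> real (Suc n) * norm (1 - cis t)"
      using Suc.IH by (simp add: algebra_simps)
    finally show ?case .
  qed simp
  have neg: "norm (1 - cis (- t)) = norm (1 - cis t)" for t
    by (simp add: cmod_def)
  show ?thesis
    using nat[of "nat \<bar>n\<bar>" t] neg[of "of_int n * t"] by (cases "n \<ge> 0") auto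
qed

lemma norm_one_minus_cis_add: "norm (1 - cis (a + b)) \<le> norm (1 - cis a) + norm (1 - cis b)"
proof -
  have "1 - cis (a + b) = (1 - cis a) + cis a * (1 - cis b)"
    by (simp add: algebra_simps cis_mult)
  then have "norm (1 - cis (a + b)) \<le> norm (1 - cis a) + norm (cis a * (1 - cis b))"
    by (simp only: norm_triangle_ineq)
  then show ?thesis by (simp only: norm_mult norm_cis mult_1)
qed

lemma norm_one_minus_cis_Gcd:
  assumes "finite S"
  shows "\<exists>C\<ge>0. \<forall>t. norm (1 - cis (real (Gcd S) * t)) \<le> C * (\<Sum>m\<in>S. norm (1 - cis (real m * t)))"
  using assms
proof induction
  case (insert a S)
  then obtain C where C: "C \<ge> 0" "\<And>t. norm (1 - cis (real (Gcd S) * t)) \<le> C * (\<Sum>m\<in>S. norm (1 - cis (real m * t)))"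
    by blast
  obtain u v where uv: "u * int a + v * int (Gcd S) = gcd (int a) (int (Gcd S))"
    using bezout_int by blast
  have g: "real (Gcd (insert a S)) = of_int u * real a + of_int v * real (Gcd S)"
    using arg_cong[OF uv, of real_of_int] by simp
  define c where "c = max (real_of_int \<bar>u\<bar>) (real_of_int \<bar>v\<bar> * C)"
  have "norm (1 - cis (real (Gcd (insert a S)) * t)) \<le> c * (\<Sum>m\<in>insert a S. norm (1 - cis (real m * t)))" for t
  proof -
    have "norm (1 - cis (real (Gcd (insert a S)) * t)) = norm (1 - cis (of_int u * (real a * t) + of_int v * (real (Gcd S) * t)))"
      unfolding g by (simp add: algebra_simps)
    also have "\<dots> \<le> real_of_int \<bar>u\<bar> * norm (1 - cis (real a * t)) + real_of_int \<bar>v\<bar> * norm (1 - cis (real (Gcd S) * t))"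
      by (intro order_trans[OF norm_one_minus_cis_add] add_mono norm_one_minus_cis_mult_int)
    also have "\<dots> \<le> real_of_int \<bar>u\<bar> * norm (1 - cis (real a * t)) + real_of_int \<bar>v\<bar> * (C * (\<Sum>m\<in>S. norm (1 - cis (real m * t))))"
      by (intro add_mono mult_left_mono C) auto
    also have "\<dots> \<le> c * norm (1 - cis (real a * t)) + c * (\<Sum>m\<in>S. norm (1 - cis (real m * t)))"
      unfolding mult.assoc[symmetric] by (intro add_mono mult_right_mono sum_nonneg) (auto simp: c_def)
    finally show ?thesis using insert.hyps by (simp add: algebra_simps)
  qed
  moreover have "c \<ge> 0" by (simp add: c_def)
  ultimately show ?case by blast
qed auto

lemma norm_one_minus_cis_sq: "(norm (1 - cis t))\<^sup>2 = 2 * (1 - cos t)"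
  unfolding cmod_power2 by (simp add: power2_eq_square algebra_simps)

text \<open>Concavity of the sine gives \<open>sin (t / 2) \<ge> t / pi\<close> on
  \<open>[0, pi]\<close>; then use \<open>1 - cos t = 2 * sin (t / 2)^2\<close>.\<close>

lemma one_minus_cos_ge:
  assumes "\<bar>t\<bar> \<le> pi"
  shows "1 - cos t \<ge> 2 * t\<^sup>2 / pi\<^sup>2"
proof -
  have pos: "1 - cos t \<ge> 2 * t\<^sup>2 / pi\<^sup>2" if t: "0 \<le> t" "t \<le> pi" for t
  proof -
    have "concave_on {0..pi} sin"
    proof (rule f''_le0_imp_concave)
      fix x :: real assume "x \<in> {0..pi}"
      then show "- sin x \<le> 0" by (simp add: sin_ge_zero)
    qed (auto intro!: derivative_eq_intros)
    from concave_onD[OF this, of "t / pi" 0 "pi / 2"] t have "t / pi \<le> sin (t / 2)"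
      by simp
    then have "(t / pi)\<^sup>2 \<le> (sin (t / 2))\<^sup>2"
      using t by (intro power_mono) auto
    moreover have "1 - cos t = 2 * (sin (t / 2))\<^sup>2"
      using cos_double_sin[of "t / 2"] by simp
    ultimately show ?thesis by (simp add: power_divide)
  qed
  show ?thesis using pos[of "\<bar>t\<bar>"] assms by simp
qed

section \<open>Second order expansion near the real axis\<close>

text \<open>The operator \<open>x * d/dx\<close> on power series; iterated on the geometric series
  it produces the moments below.\<close>

lemma sums_mult_index:
  fixes F :: "real \<Rightarrow> real"
  assumes "\<And>x. \<bar>x\<bar> < 1 \<Longrightarrow> (\<lambda>n. c n * x ^ n) sums F x"
    and "(F has_real_derivative F') (at x)" and "\<bar>x\<bar> < 1"
  shows "(\<lambda>n. real n * c n * x ^ n) sums (x * F')"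
proof -
  have "(\<lambda>n. diffs c n * x ^ n) sums F'"
    using assms by (intro termdiffs_sums_strong[of 1 c F]) auto
  from sums_mult[OF this, of x] have "(\<lambda>n. real (Suc n) * c (Suc n) * x ^ Suc n) sums (x * F')"
    by (simp add: diffs_def mult_ac)
  from sums_Suc[OF this] show ?thesis by simp
qed

lemma geometric_moments:
  fixes q :: real
  assumes "\<bar>q\<bar> < 1"
  shows "(\<lambda>n. real n * q ^ n) sums (q / (1 - q)\<^sup>2)"
    and "(\<lambda>n. real n ^ 2 * q ^ n) sums (q * (1 + q) / (1 - q) ^ 3)"
    and "(\<lambda>n. real n ^ 3 * q ^ n) sums (q * (1 + 4 * q + q\<^sup>2) / (1 - q) ^ 4)"
proof -
  have nz: "1 - x \<noteq> 0" if "\<bar>x\<bar> < 1" for x :: real using that by auto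
  have 1: "(\<lambda>n. real n * x ^ n) sums (x / (1 - x)\<^sup>2)" if x: "\<bar>x\<bar> < 1" for x
  proof -
    have 0: "(\<lambda>n. 1 * y ^ n) sums (1 / (1 - y))" if "\<bar>y\<bar> < 1" for y :: real
      using geometric_sums[of y] that by simp
    have "((\<lambda>x. 1 / (1 - x)) has_real_derivative 1 / (1 - x)\<^sup>2) (at x)"
      using nz[OF x] by (auto intro!: derivative_eq_intros simp: power2_eq_square)
    from sums_mult_index[OF 0 this x] show ?thesis by simp
  qed
  have 2: "(\<lambda>n. real n ^ 2 * x ^ n) sums (x * (1 + x) / (1 - x) ^ 3)" if x: "\<bar>x\<bar> < 1" for x
  proof -
    have "((\<lambda>x::real. x / (1 - x)\<^sup>2) has_real_derivative (1 + x) / (1 - x) ^ 3) (at x)"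
    proof -
      have "(1 * (1 - x)\<^sup>2 - x * (2 * (1 - x) * - 1)) / ((1 - x)\<^sup>2 * (1 - x)\<^sup>2) = (1 + x) / (1 - x) ^ 3"
      proof -
        define y where "y = 1 - x"
        have x_eq: "x = 1 - y" and "y \<noteq> 0" using nz[OF x] by (auto simp: y_def)
        have num: "1 * y\<^sup>2 - x * (2 * y * - 1) = y * (1 + x)"
          by (simp add: x_eq power2_eq_square algebra_simps)
        have "y\<^sup>2 * y\<^sup>2 = y * y ^ 3" by (simp add: power2_eq_square power3_eq_cube)
        with \<open>y \<noteq> 0\<close> show ?thesis unfolding y_def[symmetric] num by simp
      qed
      then show ?thesis using nz[OF x] by (auto intro!: derivative_eq_intros)
    qed
    from sums_mult_index[OF 1 this x] show ?thesis by (simp add: power2_eq_square mult_ac)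
  qed
  have 3: "(\<lambda>n. real n ^ 3 * x ^ n) sums (x * (1 + 4 * x + x\<^sup>2) / (1 - x) ^ 4)" if x: "\<bar>x\<bar> < 1" for x
  proof -
    have "((\<lambda>x::real. x * (1 + x) / (1 - x) ^ 3) has_real_derivative (1 + 4 * x + x\<^sup>2) / (1 - x) ^ 4) (at x)"
    proof -
      have "((1 + 2 * x) * (1 - x) ^ 3 - (x * (1 + x)) * (3 * (1 - x)\<^sup>2 * - 1)) / ((1 - x) ^ 3 * (1 - x) ^ 3) = (1 + 4 * x + x\<^sup>2) / (1 - x) ^ 4"
      proof -
        define y where "y = 1 - x"
        have x_eq: "x = 1 - y" and "y \<noteq> 0" using nz[OF x] by (auto simp: y_def)
        have num: "(1 + 2 * x) * y ^ 3 - (x * (1 + x)) * (3 * y\<^sup>2 * - 1) = y\<^sup>2 * (1 + 4 * x + x\<^sup>2)"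
          by (simp add: x_eq power2_eq_square power3_eq_cube algebra_simps)
        have den: "y ^ 3 * y ^ 3 = y\<^sup>2 * y ^ 4" by (simp flip: power_add)
        have "y\<^sup>2 \<noteq> 0" using \<open>y \<noteq> 0\<close> by simp
        then show ?thesis unfolding y_def[symmetric] num den by (rule mult_divide_mult_cancel_left)
      qed
      moreover have "((\<lambda>x::real. x * (1 + x) / (1 - x) ^ 3) has_real_derivative
          ((1 + 2 * x) * (1 - x) ^ 3 - (x * (1 + x)) * (3 * (1 - x)\<^sup>2 * - 1)) / ((1 - x) ^ 3 * (1 - x) ^ 3)) (at x)"
      proof (rule DERIV_divide)
        show "((\<lambda>x::real. x * (1 + x)) has_real_derivative 1 + 2 * x) (at x)"
          by (auto intro!: derivative_eq_intros)
        show "((\<lambda>x::real. (1 - x) ^ 3) has_real_derivative 3 * (1 - x)\<^sup>2 * - 1) (at x)"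
          by (auto intro!: derivative_eq_intros)
      qed (use nz[OF x] in simp)
      ultimately show ?thesis by (simp only:)
    qed
    from sums_mult_index[OF 2 this x] show ?thesis by (simp add: power2_eq_square power3_eq_cube mult_ac)
  qed
  show "(\<lambda>n. real n * q ^ n) sums (q / (1 - q)\<^sup>2)" by (rule 1[OF assms])
  show "(\<lambda>n. real n ^ 2 * q ^ n) sums (q * (1 + q) / (1 - q) ^ 3)" by (rule 2[OF assms])
  show "(\<lambda>n. real n ^ 3 * q ^ n) sums (q * (1 + 4 * q + q\<^sup>2) / (1 - q) ^ 4)" by (rule 3[OF assms])
qed

text \<open>Split the exponential evenly over the \<open>r\<close> factors: with
  \<open>y = u / r\<close>, \<open>exp (- u)\<close> is \<open>exp (- y) ^ r\<close>, and each
  factor \<open>1 - exp (- u)\<close> is at least \<open>y * exp (- y)\<close>.\<close>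

lemma exp_div_one_minus_exp_power_le:
  assumes "(u::real) > 0" "r > 0"
  shows "exp (- u) / (1 - exp (- u)) ^ r \<le> real r ^ r / u ^ r"
proof -
  define y where "y = u / real r"
  have y: "y > 0" using assms by (simp add: y_def)
  have "y \<le> u" using assms by (simp add: y_def divide_le_eq mult_le_cancel_left1)
  have "y * exp (- y) \<le> 1 - exp (- y)"
    using exp_ge_add_one_self[of y] by (simp add: exp_minus field_simps)
  also have "\<dots> \<le> 1 - exp (- u)" using \<open>y \<le> u\<close> by simp
  finally have "(y * exp (- y)) ^ r \<le> (1 - exp (- u)) ^ r"
    using y by (intro power_mono) auto
  moreover have "exp (- y) ^ r = exp (- u)"
    using assms by (simp add: y_def flip: exp_of_nat_mult)
  ultimately have "y ^ r * exp (- u) \<le> (1 - exp (- u)) ^ r"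
    by (simp add: power_mult_distrib)
  then have "exp (- u) / (1 - exp (- u)) ^ r \<le> 1 / y ^ r"
    using y assms by (simp add: divide_simps mult_ac)
  then show ?thesis by (simp add: y_def power_divide)
qed

text \<open>Second order Taylor expansion in \<open>v\<close> of \<open>\<Sum>n. exp (- n * (u + \<i> * v))\<close>.\<close>

lemma geometric_taylor_bound:
  fixes u v :: real
  assumes u: "u > 0"
  defines "q \<equiv> exp (- u)" and "z \<equiv> exp (- Complex u v)"
  shows "norm (z / (1 - z) - of_real (q / (1 - q)) + \<i> * of_real (v * (q / (1 - q)\<^sup>2)) + of_real (v\<^sup>2 / 2 * (q * (1 + q) / (1 - q) ^ 3)))
     \<le> 256 * \<bar>v\<bar> ^ 3 / u ^ 4"
proof -
  have q: "0 < q" "q < 1" using u by (auto simp: q_def)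
  have nz: "norm z = q" by (simp add: z_def q_def)
  have z_eq: "z ^ n = of_real (q ^ n) * iexp (- (real n * v))" for n
  proof -
    have "z = of_real q * iexp (- v)"
      unfolding z_def q_def by (simp add: Complex_eq exp_of_real[symmetric] exp_add[symmetric] algebra_simps)
    then show ?thesis
      by (simp add: power_mult_distrib flip: exp_of_nat_mult) (simp add: algebra_simps)
  qed
  define e where "e = (\<lambda>n. z ^ n - of_real (q ^ n) + \<i> * of_real (v * (real n * q ^ n)) + of_real (v\<^sup>2 / 2 * (real n ^ 2 * q ^ n)))"
  have E: "e sums (1 / (1 - z) - of_real (1 / (1 - q)) + \<i> * of_real (v * (q / (1 - q)\<^sup>2)) + of_real (v\<^sup>2 / 2 * (q * (1 + q) / (1 - q) ^ 3)))"
    unfolding e_def using q nz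
    by (intro sums_add sums_diff sums_mult sums_of_real geometric_moments geometric_sums) auto
  have "1 - z \<noteq> 0" using q nz by auto
  \<comment> \<open>The terms for \<open>n = 0\<close> of the two geometric series are both 1 and
    cancel, so summation may start at 0.\<close>
  then have "1 / (1 - z) = z / (1 - z) + 1" "1 / (1 - q) = q / (1 - q) + 1"
    using q by (simp_all add: divide_simps)
  then have E': "e sums (z / (1 - z) - of_real (q / (1 - q)) + \<i> * of_real (v * (q / (1 - q)\<^sup>2)) + of_real (v\<^sup>2 / 2 * (q * (1 + q) / (1 - q) ^ 3)))"
    using E by simp
  have B: "norm (e n) \<le> \<bar>v\<bar> ^ 3 / 6 * (real n ^ 3 * q ^ n)" for n
  proof -
    define w where "w = - (real n * v)"
    have "e n = of_real (q ^ n) * (iexp w - (\<Sum>k\<le>2. (\<i> * of_real w) ^ k / fact k))"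
      unfolding e_def z_eq w_def
      by (simp add: numeral_2_eq_2 algebra_simps) 
    then have "norm (e n) = q ^ n * norm (iexp w - (\<Sum>k\<le>2. (\<i> * of_real w) ^ k / fact k))"
      using q by (simp add: norm_mult norm_power)
    also have "\<dots> \<le> q ^ n * (\<bar>w\<bar> ^ Suc 2 / fact (Suc 2))"
      using q by (intro mult_left_mono iexp_approx1) auto
    also have "\<dots> = \<bar>v\<bar> ^ 3 / 6 * (real n ^ 3 * q ^ n)"
      by (simp add: w_def abs_mult power_mult_distrib eval_nat_numeral)
    finally show ?thesis .
  qed
  note M = sums_mult[OF geometric_moments(3)[of q], of "\<bar>v\<bar> ^ 3 / 6"]
  have "norm (suminf e) \<le> \<bar>v\<bar> ^ 3 / 6 * (q * (1 + 4 * q + q\<^sup>2) / (1 - q) ^ 4)"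
    using norm_suminf_le[of e, OF B] M q by (simp add: sums_iff)
  \<comment> \<open>\<open>1 + 4 * q + q^2\<close> is at most 6, which cancels the 6 of the Taylor
    remainder; 256 is \<open>4 ^ 4\<close>.\<close>
  also have "\<dots> \<le> \<bar>v\<bar> ^ 3 / 6 * (6 * (real 4 ^ 4 / u ^ 4))"
  proof (intro mult_left_mono)
    have "q * (1 + 4 * q + q\<^sup>2) / (1 - q) ^ 4 \<le> q * 6 / (1 - q) ^ 4"
      using q power_le_one[of q 2] by (intro divide_right_mono mult_left_mono) auto
    also have "\<dots> = 6 * (q / (1 - q) ^ 4)" by simp
    also have "\<dots> \<le> 6 * (real 4 ^ 4 / u ^ 4)"
      unfolding q_def using u by (intro mult_left_mono exp_div_one_minus_exp_power_le) auto
    finally show "q * (1 + 4 * q + q\<^sup>2) / (1 - q) ^ 4 \<le> 6 * (real 4 ^ 4 / u ^ 4)" .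
  qed auto
  finally show ?thesis using E' by (simp add: sums_iff)
qed

text \<open>The sum of \<open>n * exp (- n * u)\<close> over \<open>n\<close>, minus the derivative
  of the geometric series; \<open>moment2\<close> is the corresponding sum with
  \<open>n^2\<close>.\<close>

definition moment1 :: "real \<Rightarrow> real" where
  "moment1 u = exp (- u) / (1 - exp (- u))\<^sup>2"

definition moment2 :: "real \<Rightarrow> real" where
  "moment2 u = exp (- u) * (1 + exp (- u)) / (1 - exp (- u)) ^ 3"

text \<open>The exponent is a compromise. Below \<open>- 1\<close> the error is summable over the
  multiples \<open>j * x\<close>; above \<open>- 3 / 2\<close> the sum vanishes after multiplication
  by an angle of order \<open>x powr (3 / 2)\<close>.\<close>

lemma moment1_approx:
  assumes u: "u > 0"
  shows "\<bar>moment1 u - 1 / u\<^sup>2\<bar> \<le> u powr (- 5 / 4)"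
proof -
  have "moment1 u \<le> 1 / u\<^sup>2"
    unfolding moment1_def by (rule geometric_moment1_bound[OF u])
  moreover have "1 / u\<^sup>2 - moment1 u \<le> (1 - exp (- u)) / u\<^sup>2"
  proof -
    have "(1 - exp (- u))\<^sup>2 \<le> u\<^sup>2"
      using one_minus_exp_le[of u] u by (intro power_mono) auto
    then have "exp (- u) / u\<^sup>2 \<le> moment1 u"
      unfolding moment1_def using u by (intro divide_left_mono mult_pos_pos) auto
    then show ?thesis by (simp add: diff_divide_distrib)
  qed
  moreover have "(1 - exp (- u)) / u\<^sup>2 \<le> u powr (- 5 / 4)"
  proof -
    have "1 - exp (- u) \<le> u powr (3 / 4)"
    proof (cases "u \<le> 1")
      case True
      have "u powr 1 \<le> u powr (3 / 4)" using u True by (intro powr_mono') auto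
      with one_minus_exp_le[of u] u show ?thesis by simp
    next
      case False
      then have "1 \<le> u powr (3 / 4)" by (intro ge_one_powr_ge_zero) auto
      then show ?thesis using exp_gt_zero[of "- u"] by linarith
    qed
    then have "(1 - exp (- u)) / u\<^sup>2 \<le> u powr (3 / 4) / u powr 2"
      using u by (simp add: divide_right_mono)
    also have "\<dots> = u powr (- 5 / 4)" by (simp flip: powr_diff)
    finally show ?thesis .
  qed
  ultimately show ?thesis by linarith
qed

lemma moment2_bounds:
  assumes u: "u > 0"
  shows "0 \<le> moment2 u" "moment2 u \<le> 54 / u ^ 3"
proof -
  have q: "0 < exp (- u)" "exp (- u) < 1" using u by auto
  then show "0 \<le> moment2 u" by (simp add: moment2_def)
  have "moment2 u \<le> exp (- u) * 2 / (1 - exp (- u)) ^ 3"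
    unfolding moment2_def using q by (intro divide_right_mono mult_left_mono) auto
  also have "\<dots> = 2 * (exp (- u) / (1 - exp (- u)) ^ 3)" by simp
  also have "\<dots> \<le> 2 * (real 3 ^ 3 / u ^ 3)"
    using u by (intro mult_left_mono exp_div_one_minus_exp_power_le) auto
  finally show "moment2 u \<le> 54 / u ^ 3" by simp
qed

lemma summable_powr_Suc: "summable (\<lambda>j. real (Suc j) powr (- 5 / 4))"
  using summable_real_powr_iff[of "- 5 / 4"] summable_Suc_iff[of "\<lambda>j. real j powr (- 5 / 4)"] by simp

lemma moment1_series:
  assumes x: "x > 0"
  shows "summable (\<lambda>j. moment1 (real (Suc j) * x))"
    and "\<bar>(\<Sum>j. moment1 (real (Suc j) * x)) - pi\<^sup>2 / 6 / x\<^sup>2\<bar> \<le> (\<Sum>j. real (Suc j) powr (- 5 / 4)) * x powr (- 5 / 4)"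
proof -
  have B: "norm (moment1 (real (Suc j) * x) - 1 / real (Suc j) ^ 2 / x\<^sup>2) \<le> real (Suc j) powr (- 5 / 4) * x powr (- 5 / 4)" for j
    using moment1_approx[of "real (Suc j) * x"] x
    by (simp add: power_mult_distrib powr_mult del: of_nat_Suc)
  have S: "summable (\<lambda>j. real (Suc j) powr (- 5 / 4) * x powr (- 5 / 4))"
    by (intro summable_mult2 summable_powr_Suc)
  have D: "summable (\<lambda>j. moment1 (real (Suc j) * x) - 1 / real (Suc j) ^ 2 / x\<^sup>2)"
    by (rule summable_comparison_test'[OF S]) (use B in blast)
  have I: "summable (\<lambda>j. 1 / real (Suc j) ^ 2 / x\<^sup>2)"
    by (intro summable_divide summable_inverse_squares)
  show M: "summable (\<lambda>j. moment1 (real (Suc j) * x))"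
    using summable_add[OF D I] by simp
  have "(\<Sum>j. moment1 (real (Suc j) * x) - 1 / real (Suc j) ^ 2 / x\<^sup>2) = (\<Sum>j. moment1 (real (Suc j) * x)) - pi\<^sup>2 / 6 / x\<^sup>2"
    unfolding suminf_diff[OF M I, symmetric] suminf_divide[OF summable_inverse_squares] suminf_inverse_squares ..
  with norm_suminf_le[OF B S] suminf_mult2[OF summable_powr_Suc, of "x powr (- 5 / 4)"]
  show "\<bar>(\<Sum>j. moment1 (real (Suc j) * x)) - pi\<^sup>2 / 6 / x\<^sup>2\<bar> \<le> (\<Sum>j. real (Suc j) powr (- 5 / 4)) * x powr (- 5 / 4)"
    by simp
qed

lemma moment2_term_bound:
  assumes "x > 0"
  shows "norm (real (Suc j) * moment2 (real (Suc j) * x)) \<le> 54 / x ^ 3 * (1 / real (Suc j) ^ 2)"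
proof -
  have "norm (real (Suc j) * moment2 (real (Suc j) * x)) \<le> real (Suc j) * (54 / (real (Suc j) * x) ^ 3)"
    unfolding norm_mult using moment2_bounds[of "real (Suc j) * x"] assms
    by (intro mult_mono) (auto simp del: of_nat_Suc)
  also have "\<dots> = 54 / x ^ 3 * (1 / real (Suc j) ^ 2)"
    by (simp add: power_mult_distrib power2_eq_square power3_eq_cube del: of_nat_Suc)
  finally show ?thesis .
qed

lemma moment2_summable:
  assumes "x > 0"
  shows "summable (\<lambda>j. real (Suc j) * moment2 (real (Suc j) * x))"
  by (rule summable_comparison_test'[OF summable_mult[OF summable_inverse_squares, of "54 / x ^ 3"]])
     (use moment2_term_bound[OF assms] in blast)

text \<open>\<open>u^3 * moment2 u\<close> tends to 2, so the term of index \<open>j\<close> tends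
  to \<open>2 / (j + 1)^2\<close>. The bound \<open>54 / u^3\<close> supplies the majorant for
  Tannery's theorem.\<close>

lemma moment2_series_tendsto:
  "((\<lambda>x. x ^ 3 * (\<Sum>j. real (Suc j) * moment2 (real (Suc j) * x))) \<longlongrightarrow> pi\<^sup>2 / 3) (at_right 0)"
proof -
  have "((\<lambda>x. \<Sum>j. x ^ 3 * (real (Suc j) * moment2 (real (Suc j) * x))) \<longlongrightarrow> (\<Sum>j. 2 * (1 / real (Suc j) ^ 2))) (at_right 0)"
  proof (rule conjunct2[OF conjunct2[OF tannerys_theorem]])
    fix j
    have "((\<lambda>u. u ^ 3 * moment2 u) \<longlongrightarrow> 2) (at_right 0)"
      unfolding moment2_def by real_asymp
    moreover have "filterlim (\<lambda>x. real (Suc j) * x) (at_right 0) (at_right 0)"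
      by real_asymp
    ultimately have "((\<lambda>x. (real (Suc j) * x) ^ 3 * moment2 (real (Suc j) * x)) \<longlongrightarrow> 2) (at_right 0)"
      by (rule filterlim_compose)
    then have "((\<lambda>x. (real (Suc j) * x) ^ 3 * moment2 (real (Suc j) * x) / real (Suc j) ^ 2) \<longlongrightarrow> 2 / real (Suc j) ^ 2) (at_right 0)"
      by (intro tendsto_divide) auto
    then show "((\<lambda>x. x ^ 3 * (real (Suc j) * moment2 (real (Suc j) * x))) \<longlongrightarrow> 2 * (1 / real (Suc j) ^ 2)) (at_right 0)"
      by (simp add: power_mult_distrib power2_eq_square power3_eq_cube mult_ac del: of_nat_Suc)
  next
    have B: "norm (x ^ 3 * (real (Suc j) * moment2 (real (Suc j) * x))) \<le> 54 * (1 / real (Suc j) ^ 2)" if "x > 0" for x j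
    proof -
      have "norm (x ^ 3 * (real (Suc j) * moment2 (real (Suc j) * x))) \<le> x ^ 3 * (54 / x ^ 3 * (1 / real (Suc j) ^ 2))"
        using moment2_term_bound[OF that, of j] that unfolding norm_mult[of "x ^ 3"]
        by (intro mult_mono) (auto simp del: of_nat_Suc)
      with that show ?thesis by simp
    qed
    show "\<forall>\<^sub>F (j, x) in at_top \<times>\<^sub>F at_right 0. norm (x ^ 3 * (real (Suc j) * moment2 (real (Suc j) * x))) \<le> 54 * (1 / real (Suc j) ^ 2)"
      unfolding eventually_prod_filter
      by (rule exI[of _ "\<lambda>_. True"], rule exI[of _ "\<lambda>x. x > 0"])
         (use B in \<open>auto intro: eventually_at_right_less simp del: of_nat_Suc\<close>)
    show "summable (\<lambda>j. 54 * (1 / real (Suc j) ^ 2))"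
      by (intro summable_mult summable_inverse_squares)
  qed auto
  also have "(\<Sum>j. 2 * (1 / real (Suc j) ^ 2)) = pi\<^sup>2 / 3"
    by (subst suminf_mult[OF summable_inverse_squares]) (simp only: suminf_inverse_squares)
  finally show ?thesis
  proof (rule Lim_transform_eventually)
    show "\<forall>\<^sub>F x in at_right 0. (\<Sum>j. x ^ 3 * (real (Suc j) * moment2 (real (Suc j) * x))) = x ^ 3 * (\<Sum>j. real (Suc j) * moment2 (real (Suc j) * x))"
      using eventually_at_right_less by eventually_elim (intro suminf_mult moment2_summable)
  qed
qed

text \<open>Use \<open>geometric_taylor_bound\<close> at \<open>J * x\<close> and
  \<open>J * \<phi>\<close>, where \<open>J = j + 1\<close>. The weight \<open>1 / J\<close> and the
  error \<open>J^3 / J^4\<close> combine to the summable \<open>1 / J^2\<close>.\<close>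

lemma plog_increment_bound:
  fixes x \<phi> :: real
  assumes x: "x > 0"
  shows "norm (plog (exp (- Complex x \<phi>)) - of_real (plog (exp (- x)))
     + \<i> * of_real (\<phi> * (\<Sum>j. moment1 (real (Suc j) * x)))
     + of_real (\<phi>\<^sup>2 / 2 * (\<Sum>j. real (Suc j) * moment2 (real (Suc j) * x)))) \<le> 256 * \<bar>\<phi>\<bar> ^ 3 / x ^ 4 * (pi\<^sup>2 / 6)"
proof -
  let ?z = "exp (- Complex x \<phi>)" and ?q = "exp (- x)"
  have nz: "norm ?z < 1" and nq: "norm ?q < 1" using x by auto
  define t where "t = (\<lambda>j. ?z ^ Suc j / (of_nat (Suc j) * (1 - ?z ^ Suc j)) - of_real (?q ^ Suc j / (of_nat (Suc j) * (1 - ?q ^ Suc j)))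
      + \<i> * of_real (\<phi> * moment1 (real (Suc j) * x)) + of_real (\<phi>\<^sup>2 / 2 * (real (Suc j) * moment2 (real (Suc j) * x))))"
  have S: "t sums (plog ?z - of_real (plog ?q) + \<i> * of_real (\<phi> * (\<Sum>j. moment1 (real (Suc j) * x)))
     + of_real (\<phi>\<^sup>2 / 2 * (\<Sum>j. real (Suc j) * moment2 (real (Suc j) * x))))"
    unfolding t_def plog_def
    by (intro sums_add sums_diff sums_mult sums_of_real summable_sums summable_plog nz nq moment1_series(1) moment2_summable x)
  have B: "norm (t j) \<le> 256 * \<bar>\<phi>\<bar> ^ 3 / x ^ 4 * (1 / real (Suc j) ^ 2)" for j
  proof -
    define J where "J = real (Suc j)"
    have J: "J > 0" by (simp add: J_def)
    have zJ: "?z ^ Suc j = exp (- Complex (J * x) (J * \<phi>))"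
      unfolding exp_of_nat_mult[symmetric] J_def by (simp add: Complex_eq algebra_simps)
    have qJ: "?q ^ Suc j = exp (- (J * x))"
      unfolding exp_of_nat_mult[symmetric] J_def by (simp add: algebra_simps)
    define Z Q where "Z = exp (- Complex (J * x) (J * \<phi>))" and "Q = exp (- (J * x))"
    have t: "t j = of_real (1 / J) * (Z / (1 - Z) - of_real (Q / (1 - Q)) + \<i> * of_real (J * \<phi> * moment1 (J * x))
        + of_real ((J * \<phi>)\<^sup>2 / 2 * moment2 (J * x)))"
    proof -
      define j' where "j' = complex_of_real J"
      have "j' \<noteq> 0" using J by (simp add: j'_def)
      have "Z / (j' * (1 - Z)) - Q' + \<i> * (p * m) + p\<^sup>2 / 2 * (j' * n)
          = 1 / j' * (Z / (1 - Z) - j' * Q' + \<i> * (j' * p * m) + (j' * p)\<^sup>2 / 2 * n)" for Q' p m n :: complex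
        using \<open>j' \<noteq> 0\<close> by (simp add: ring_distribs power2_eq_square)
      moreover have "j' * of_real (Q / (J * (1 - Q))) = of_real (Q / (1 - Q))"
        using J by (simp add: j'_def)
      moreover have "of_nat (Suc j) = j'" "real (Suc j) = J"
        by (simp_all add: j'_def J_def)
      ultimately show ?thesis
        unfolding t_def zJ qJ Z_def[symmetric] Q_def[symmetric]
        by (simp only: of_real_mult of_real_divide of_real_power of_real_numeral of_real_1 j'_def[symmetric])
    qed
    have "norm (t j) \<le> 1 / J * (256 * \<bar>J * \<phi>\<bar> ^ 3 / (J * x) ^ 4)"
      unfolding t norm_mult norm_of_real
    proof (rule mult_mono)
      show "norm (Z / (1 - Z) - of_real (Q / (1 - Q)) + \<i> * of_real (J * \<phi> * moment1 (J * x))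
        + of_real ((J * \<phi>)\<^sup>2 / 2 * moment2 (J * x))) \<le> 256 * \<bar>J * \<phi>\<bar> ^ 3 / (J * x) ^ 4"
        using geometric_taylor_bound[of "J * x" "J * \<phi>"] J x
        by (simp only: Z_def Q_def moment1_def moment2_def mult_pos_pos)
    qed (use J in auto)
    also have "\<dots> = 256 * \<bar>\<phi>\<bar> ^ 3 / x ^ 4 * (1 / J ^ 2)"
    proof -
      have "1 / J * (256 * (J * p) ^ 3 / (J * x) ^ 4) = 256 * p ^ 3 / x ^ 4 * (1 / J ^ 2)" for p
        using J by (simp add: power_mult_distrib power2_eq_square power3_eq_cube power4_eq_xxxx mult_ac)
      from this[of "\<bar>\<phi>\<bar>"] show ?thesis using J by (simp only: abs_mult abs_of_pos)
    qed
    finally show ?thesis by (simp only: J_def)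
  qed
  have "norm (suminf t) \<le> 256 * \<bar>\<phi>\<bar> ^ 3 / x ^ 4 * (pi\<^sup>2 / 6)"
    using norm_suminf_le[of t, OF B summable_mult[OF summable_inverse_squares]]
    by (simp only: suminf_mult[OF summable_inverse_squares] suminf_inverse_squares)
  then show ?thesis using S by (simp only: sums_iff)
qed

text \<open>At the angle \<open>s * x powr (3 / 2)\<close> the cubic error is of order
  \<open>sqrt x\<close> and the quadratic term has a finite limit. The linear term diverges like
  \<open>1 / sqrt x\<close>, so it is kept in the statement, to be cancelled later by the Fourier
  kernel.\<close>

lemma plog_increment_tendsto:
  fixes s :: real
  shows "((\<lambda>x. plog (exp (- Complex x (s * (x * sqrt x)))) - of_real (plog (exp (- x)))
     + \<i> * of_real (s * pi\<^sup>2 / (6 * sqrt x))) \<longlongrightarrow> of_real (- (s\<^sup>2 * pi\<^sup>2 / 6))) (at_right 0)"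
proof -
  define f where "f = (\<lambda>x. s * (x * sqrt x))"
  define S1 S2 where "S1 = (\<lambda>x. \<Sum>j. moment1 (real (Suc j) * x))"
    and "S2 = (\<lambda>x. \<Sum>j. real (Suc j) * moment2 (real (Suc j) * x))"
  define D where "D = (\<lambda>x. plog (exp (- Complex x (f x))) - of_real (plog (exp (- x))))"
  define C where "C = (\<Sum>j. real (Suc j) powr (- 5 / 4))"
  have 1: "((\<lambda>x. D x + \<i> * of_real (f x * S1 x) + of_real ((f x)\<^sup>2 / 2 * S2 x)) \<longlongrightarrow> 0) (at_right 0)"
  proof (rule Lim_null_comparison)
    show "\<forall>\<^sub>F x in at_right 0. norm (D x + \<i> * of_real (f x * S1 x) + of_real ((f x)\<^sup>2 / 2 * S2 x)) \<le> 256 * \<bar>s\<bar> ^ 3 * (pi\<^sup>2 / 6) * sqrt x"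
      using eventually_at_right_less
    proof eventually_elim
      case (elim x)
      have "\<bar>x * sqrt x\<bar> ^ 3 = x ^ 4 * sqrt x"
        using elim by (simp add: power_mult_distrib power3_eq_cube power4_eq_xxxx)
      then have "\<bar>f x\<bar> ^ 3 = \<bar>s\<bar> ^ 3 * (x ^ 4 * sqrt x)"
        by (simp only: f_def abs_mult[of s] power_mult_distrib[of "\<bar>s\<bar>"])
      then have "256 * \<bar>f x\<bar> ^ 3 / x ^ 4 * (pi\<^sup>2 / 6) = 256 * \<bar>s\<bar> ^ 3 * (pi\<^sup>2 / 6) * sqrt x"
        using elim by simp
      then show ?case using plog_increment_bound[OF elim, of "f x"] by (simp only: D_def S1_def S2_def)
    qed
    show "((\<lambda>x. 256 * \<bar>s\<bar> ^ 3 * (pi\<^sup>2 / 6) * sqrt x) \<longlongrightarrow> 0) (at_right 0)"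
      by (auto intro!: tendsto_eq_intros)
  qed
  have 2: "((\<lambda>x. (f x)\<^sup>2 / 2 * S2 x) \<longlongrightarrow> s\<^sup>2 / 2 * (pi\<^sup>2 / 3)) (at_right 0)"
  proof -
    have "((\<lambda>x. s\<^sup>2 / 2 * (x ^ 3 * S2 x)) \<longlongrightarrow> s\<^sup>2 / 2 * (pi\<^sup>2 / 3)) (at_right 0)"
      unfolding S2_def by (intro tendsto_mult tendsto_const moment2_series_tendsto)
    moreover have "\<forall>\<^sub>F x in at_right 0. s\<^sup>2 / 2 * (x ^ 3 * S2 x) = (f x)\<^sup>2 / 2 * S2 x"
      using eventually_at_right_less
    proof eventually_elim
      case (elim x)
      then show ?case by (simp add: f_def power_mult_distrib power3_eq_cube power2_eq_square)
    qed
    ultimately show ?thesis by (rule Lim_transform_eventually)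
  qed
  have 3: "((\<lambda>x. f x * S1 x - s * pi\<^sup>2 / (6 * sqrt x)) \<longlongrightarrow> 0) (at_right 0)"
  proof (rule Lim_null_comparison)
    show "\<forall>\<^sub>F x in at_right 0. norm (f x * S1 x - s * pi\<^sup>2 / (6 * sqrt x)) \<le> \<bar>s\<bar> * C * x powr (1 / 4)"
      using eventually_at_right_less
    proof eventually_elim
      case (elim x)
      have eq: "f x * (pi\<^sup>2 / 6 / x\<^sup>2) = s * pi\<^sup>2 / (6 * sqrt x)"
        using elim by (simp add: f_def power2_eq_square field_simps)
      have "norm (f x * S1 x - s * pi\<^sup>2 / (6 * sqrt x)) = \<bar>f x\<bar> * \<bar>S1 x - pi\<^sup>2 / 6 / x\<^sup>2\<bar>"
        unfolding eq[symmetric] abs_mult[symmetric] by (simp add: right_diff_distrib)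
      also have "\<dots> \<le> \<bar>f x\<bar> * (C * x powr (- 5 / 4))"
        unfolding S1_def C_def by (intro mult_left_mono moment1_series(2) elim) auto
      also have "\<dots> = \<bar>s\<bar> * C * (x powr 1 * x powr (1 / 2) * x powr (- 5 / 4))"
        using elim by (simp add: f_def abs_mult powr_half_sqrt)
      also have "x powr 1 * x powr (1 / 2) * x powr (- 5 / 4) = x powr (1 / 4)"
        by (simp only: powr_add[symmetric]) simp
      finally show ?case .
    qed
    show "((\<lambda>x. \<bar>s\<bar> * C * x powr (1 / 4)) \<longlongrightarrow> 0) (at_right 0)"
      by real_asymp
  qed
  have "((\<lambda>x. (D x + \<i> * of_real (f x * S1 x) + of_real ((f x)\<^sup>2 / 2 * S2 x)) - of_real ((f x)\<^sup>2 / 2 * S2 x)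
      - \<i> * of_real (f x * S1 x - s * pi\<^sup>2 / (6 * sqrt x))) \<longlongrightarrow> 0 - of_real (s\<^sup>2 / 2 * (pi\<^sup>2 / 3)) - \<i> * of_real 0) (at_right 0)"
    by (intro tendsto_diff tendsto_mult tendsto_const tendsto_of_real 1 2 3)
  then show ?thesis by (simp add: D_def f_def algebra_simps)
qed

section \<open>Formal products and their evaluation in the unit disc\<close>

unbundle no vec_syntax
notation fps_nth (infixl \<open>$\<close> 75)

text \<open>The inverse of \<open>1 - fps_X ^ b\<close>. Giving its coefficients explicitly makes
  nonnegativity and the substitution of \<open>fps_X ^ d\<close> immediate.\<close>

definition geo :: "nat \<Rightarrow> real fps" where
  "geo b = Abs_fps (\<lambda>n. if b dvd n then 1 else 0)"

lemma geo_mult: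
  assumes "b > 0"
  shows "geo b * (1 - fps_X ^ b) = 1"
proof (rule fps_ext)
  fix n
  have "(geo b * (1 - fps_X ^ b)) $ n = geo b $ n - (if n < b then 0 else geo b $ (n - b))"
    by (simp add: algebra_simps fps_X_power_mult_right_nth)
  also have "\<dots> = (if n = 0 then 1 else 0)"
    using assms by (auto simp: geo_def dvd_minus_self dest: dvd_imp_le)
  finally show "(geo b * (1 - fps_X ^ b)) $ n = 1 $ n" by simp
qed

text \<open>\<open>powi\<close> binds more tightly than division, so the left side is the reciprocal
  of a power, with a unit as denominator.\<close>

lemma geo_power_eq:
  assumes "b > 0" "c \<ge> 0"
  shows "1 / (1 - fps_X ^ b) powi c = geo b ^ nat c"
proof -
  define y :: "real fps" where "y = 1 - fps_X ^ b"
  have "geo b ^ nat c * y ^ nat c = 1"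
    using geo_mult[OF assms(1)] by (simp add: y_def flip: power_mult_distrib)
  then have "inverse (y ^ nat c) = geo b ^ nat c"
    by (intro fps_inverse_unique) (simp add: mult.commute)
  moreover have "(y ^ nat c) $ 0 \<noteq> 0"
    using assms by (simp add: y_def fps_nth_power_0 zero_power)
  moreover have "y powi c = y ^ nat c"
    using assms power_int_of_nat[of y "nat c"] by simp
  ultimately show ?thesis
    by (simp add: fps_divide_unit flip: y_def)
qed

lemma geo_power_nth_low:
  assumes "n < b"
  shows "(geo b ^ c) $ n = 1 $ n"
  using assms
proof (induction c arbitrary: n)
  case (Suc c)
  have "(geo b ^ Suc c) $ n = (\<Sum>i\<le>n. geo b $ i * 1 $ (n - i))"
    using Suc by (auto simp: fps_mult_nth atLeast0AtMost intro!: sum.cong)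
  also have "\<dots> = (\<Sum>i\<in>{n}. geo b $ i)"
    by (rule sum.mono_neutral_cong_right) auto
  also have "\<dots> = 1 $ n" using Suc.prems by (auto simp: geo_def dest: dvd_imp_le)
  finally show ?case .
qed simp

lemma mult_geo_power_nth_low:
  assumes "n < b"
  shows "(f * geo b ^ c) $ n = f $ n"
proof -
  have "(f * geo b ^ c) $ n = (\<Sum>i\<le>n. f $ i * 1 $ (n - i))"
    using assms geo_power_nth_low by (auto simp: fps_mult_nth atLeast0AtMost intro!: sum.cong)
  also have "\<dots> = (\<Sum>i\<in>{n}. f $ i)"
    by (rule sum.mono_neutral_cong_right) auto
  finally show ?thesis by simp
qed

text \<open>The coefficient at \<open>N\<close> is final once the factors up to index
  \<open>N\<close> are multiplied, so the limit can be read off the diagonal.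
  \<open>has_prod\<close> also demands a nonzero limit, which the constant coefficient 1
  ensures.\<close>

lemma geo_prod_has_prod:
  assumes "m > 0"
  shows "\<exists>P. (\<lambda>n. geo (m * Suc n) ^ c) has_prod P \<and> (\<lambda>K. \<Prod>n\<le>K. geo (m * Suc n) ^ c) \<longlonglongrightarrow> P"
proof -
  define f where "f = (\<lambda>n. geo (m * Suc n) ^ c)"
  define P where "P = Abs_fps (\<lambda>N. (\<Prod>n\<le>N. f n) $ N)"
  have stable: "(\<Prod>n\<le>N + j. f n) $ N = (\<Prod>n\<le>N. f n) $ N" for N j
  proof (induction j)
    case (Suc j)
    have "1 * (N + Suc j) \<le> m * (N + Suc j)" using assms by (intro mult_right_mono) auto
    then have "N < m * Suc (N + Suc j)" using assms by simp
    from mult_geo_power_nth_low[OF this, of "\<Prod>n\<le>N + j. f n" c]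
    show ?case using Suc by (simp add: f_def del: mult_Suc_right)
  qed simp
  have "(\<lambda>K. \<Prod>n\<le>K. f n) \<longlonglongrightarrow> P"
  proof (rule tendsto_fpsI)
    fix N
    show "\<forall>\<^sub>F K in sequentially. (\<Prod>n\<le>K. f n) $ N = P $ N"
      using eventually_ge_at_top[of N]
    proof eventually_elim
      case (elim K)
      then show ?case using stable[of N "K - N"] by (simp add: P_def)
    qed
  qed
  moreover have "P $ 0 = 1"
    using assms geo_power_nth_low[of 0 m c] by (simp add: P_def f_def)
  then have "P \<noteq> 0" by auto
  ultimately show ?thesis
    unfolding has_prod_def raw_has_prod_def f_def by auto
qed

lemma tendsto_fps_mult:
  fixes f g :: "'b \<Rightarrow> real fps"
  assumes "(f \<longlongrightarrow> F) L" "(g \<longlongrightarrow> G) L"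
  shows "((\<lambda>x. f x * g x) \<longlongrightarrow> F * G) L"
proof (rule tendsto_fpsI)
  fix n
  have "\<forall>\<^sub>F x in L. \<forall>i\<in>{..n}. f x $ i = F $ i" "\<forall>\<^sub>F x in L. \<forall>i\<in>{..n}. g x $ i = G $ i"
    using assms by (auto simp: tendsto_fps_iff intro!: eventually_ball_finite)
  then show "\<forall>\<^sub>F x in L. (f x * g x) $ n = (F * G) $ n"
    by eventually_elim (simp add: fps_mult_nth)
qed

lemma tendsto_fps_prod:
  fixes f :: "'a \<Rightarrow> 'b \<Rightarrow> real fps"
  assumes "\<And>i. i \<in> I \<Longrightarrow> (f i \<longlongrightarrow> F i) L"
  shows "((\<lambda>x. \<Prod>i\<in>I. f i x) \<longlongrightarrow> (\<Prod>i\<in>I. F i)) L"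
  using assms by (induction I rule: infinite_finite_induct) (auto intro: tendsto_fps_mult)

definition partition_prod :: "nat \<Rightarrow> (nat \<Rightarrow> int) \<Rightarrow> nat \<Rightarrow> real fps" where
  "partition_prod k e K = (\<Prod>m=1..k. \<Prod>n\<le>K. geo (m * Suc n) ^ nat (e m))"

text \<open>Formal series converge when each coefficient becomes constant, so properties of
  \<open>gen_partition\<close> can be transferred from finite products one coefficient at a
  time.\<close>

lemma eventually_partition_prod_nth:
  assumes "\<And>m. m \<in> {1..k} \<Longrightarrow> e m \<ge> 0"
  shows "\<forall>\<^sub>F K in sequentially. partition_prod k e K $ N = gen_partition k e N"
proof -
  have "(\<lambda>K. \<Prod>n\<le>K. geo (m * Suc n) ^ nat (e m)) \<longlonglongrightarrow> (\<Prod>n. 1 / (1 - fps_X ^ (m * Suc n)) powi e m)"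
    if m: "m \<in> {1..k}" for m
  proof -
    obtain P where P: "(\<lambda>n. geo (m * Suc n) ^ nat (e m)) has_prod P"
      "(\<lambda>K. \<Prod>n\<le>K. geo (m * Suc n) ^ nat (e m)) \<longlonglongrightarrow> P"
      using geo_prod_has_prod[of m "nat (e m)"] m by auto
    have "1 / (1 - fps_X ^ (m * Suc n)) powi e m = geo (m * Suc n) ^ nat (e m)" for n
      using m assms[OF m] by (intro geo_power_eq) auto
    then show ?thesis using P has_prod_unique[OF P(1)] by simp
  qed
  then have "partition_prod k e \<longlonglongrightarrow> (\<Prod>m=1..k. \<Prod>n. 1 / (1 - fps_X ^ (m * Suc n)) powi e m)"
    unfolding partition_prod_def[abs_def] by (rule tendsto_fps_prod)
  then show ?thesis
    by (simp add: tendsto_fps_iff gen_partition_def)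
qed

section \<open>Dividing out a common divisor of the support\<close>

lemma geo_compose:
  assumes "d > 0"
  shows "geo b oo fps_X ^ d = geo (d * b)"
proof (rule fps_ext)
  fix n
  have "d * b dvd n \<longleftrightarrow> d dvd n \<and> b dvd n div d"
    using assms by (metis dvd_mult_div_cancel dvd_mult_left nat_mult_dvd_cancel_disj not_gr_zero)
  then show "(geo b oo fps_X ^ d) $ n = geo (d * b) $ n"
    by (auto simp: fps_nth_compose_X_power geo_def)
qed

text \<open>Only factors with \<open>d dvd m\<close> differ from 1, so the finite products are those
  of the reduced exponents with \<open>fps_X ^ d\<close> substituted.\<close>

lemma gen_partition_dilate:
  assumes d: "d > 0" and e: "\<And>m. m \<in> {1..k} \<Longrightarrow> e m \<ge> 0"
    and supp: "\<And>m. m \<in> {1..k} \<Longrightarrow> e m \<noteq> 0 \<Longrightarrow> d dvd m"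
  shows "gen_partition k e (d * n) = gen_partition (k div d) (\<lambda>m. e (d * m)) n"
proof -
  have dm: "d * m \<in> {1..k}" if "m \<in> {1..k div d}" for m
    using that d by (auto simp: less_eq_div_iff_mult_less_eq mult.commute Suc_le_eq)
  have X0: "(fps_X ^ d :: real fps) $ 0 = 0" using d by simp
  have "partition_prod k e K = partition_prod (k div d) (\<lambda>m. e (d * m)) K oo fps_X ^ d" for K
  proof -
    have "partition_prod (k div d) (\<lambda>m. e (d * m)) K oo fps_X ^ d
        = (\<Prod>m=1..k div d. \<Prod>n\<le>K. geo (d * m * Suc n) ^ nat (e (d * m)))"
      unfolding partition_prod_def fps_compose_prod_distrib[OF X0]
      by (simp add: geo_compose[OF d] mult.assoc flip: fps_compose_power[OF X0] del: mult_Suc_right)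
    also have "\<dots> = (\<Prod>m\<in>(*) d ` {1..k div d}. \<Prod>n\<le>K. geo (m * Suc n) ^ nat (e m))"
      using d by (subst prod.reindex) (auto simp: inj_on_def)
    also have "\<dots> = (\<Prod>m=1..k. \<Prod>n\<le>K. geo (m * Suc n) ^ nat (e m))"
    proof (rule prod.mono_neutral_left)
      show "\<forall>m\<in>{1..k} - (*) d ` {1..k div d}. (\<Prod>n\<le>K. geo (m * Suc n) ^ nat (e m)) = 1"
      proof
        fix m assume m: "m \<in> {1..k} - (*) d ` {1..k div d}"
        have "e m = 0"
        proof (rule ccontr)
          assume "e m \<noteq> 0"
          then obtain j where j: "m = d * j" using supp[of m] m by (auto elim: dvdE)
          then have "j \<in> {1..k div d}"
            using m d by (auto simp: less_eq_div_iff_mult_less_eq mult.commute Suc_le_eq)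
          with m j show False by auto
        qed
        then show "(\<Prod>n\<le>K. geo (m * Suc n) ^ nat (e m)) = 1" by simp
      qed
    qed (use dm in auto)
    finally show ?thesis by (simp add: partition_prod_def)
  qed
  then have dilate: "partition_prod k e K $ (d * n) = partition_prod (k div d) (\<lambda>m. e (d * m)) K $ n" for K
    using d by (simp add: fps_nth_compose_X_power)
  have "\<forall>\<^sub>F K in sequentially. partition_prod k e K $ (d * n) = gen_partition k e (d * n)"
    by (intro eventually_partition_prod_nth e)
  moreover have "\<forall>\<^sub>F K in sequentially. partition_prod (k div d) (\<lambda>m. e (d * m)) K $ n = gen_partition (k div d) (\<lambda>m. e (d * m)) n"
    using dm e by (intro eventually_partition_prod_nth) auto
  ultimately have "\<forall>\<^sub>F K in sequentially. gen_partition k e (d * n) = gen_partition (k div d) (\<lambda>m. e (d * m)) n"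
    by eventually_elim (simp add: dilate)
  then show ?thesis by simp
qed

text \<open>A relation rather than an evaluation map, so that convergence in the whole disc travels
  with the value through products.\<close>

definition disc_eval :: "real fps \<Rightarrow> (complex \<Rightarrow> complex) \<Rightarrow> bool" where
  "disc_eval f F \<longleftrightarrow> (\<forall>q. norm q < 1 \<longrightarrow> (\<lambda>n. of_real (f $ n) * q ^ n) sums F q)"

lemma disc_eval_summable_norm:
  fixes q :: complex
  assumes "disc_eval f F" "norm q < 1"
  shows "summable (\<lambda>n. norm (of_real (f $ n) * q ^ n))"
proof -
  \<comment> \<open>A radius strictly between \<open>norm q\<close> and 1: convergence there implies
    absolute convergence at \<open>q\<close>.\<close>
  let ?r = "complex_of_real ((norm q + 1) / 2)"
  have "norm ?r < 1" "norm q < norm ?r" using assms(2) unfolding norm_of_real by auto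
  moreover from this have "summable (\<lambda>n. of_real (f $ n) * ?r ^ n)"
    using assms(1) by (auto simp only: disc_eval_def sums_iff)
  ultimately show ?thesis
    using powser_insidea[of "\<lambda>n. of_real (f $ n)" ?r q] by blast
qed

lemma disc_eval_1: "disc_eval 1 (\<lambda>_. 1)"
  unfolding disc_eval_def
proof (intro allI impI)
  fix q :: complex
  have "(\<lambda>n. complex_of_real (1 $ n) * q ^ n) sums (\<Sum>n\<in>{0}. complex_of_real (1 $ n) * q ^ n)"
    by (rule sums_finite) auto
  then show "(\<lambda>n. complex_of_real (1 $ n) * q ^ n) sums 1" by simp
qed

lemma disc_eval_mult:
  assumes "disc_eval f F" "disc_eval g G"
  shows "disc_eval (f * g) (\<lambda>q. F q * G q)"
  unfolding disc_eval_def
proof (intro allI impI)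
  fix q :: complex assume q: "norm q < 1"
  have "(\<lambda>n. \<Sum>i\<le>n. of_real (f $ i) * q ^ i * (of_real (g $ (n - i)) * q ^ (n - i))) sums (F q * G q)"
    using Cauchy_product_sums[OF disc_eval_summable_norm[OF assms(1) q] disc_eval_summable_norm[OF assms(2) q]]
      assms q by (simp add: disc_eval_def sums_iff)
  moreover have "(\<Sum>i\<le>n. of_real (f $ i) * q ^ i * (of_real (g $ (n - i)) * q ^ (n - i))) = of_real ((f * g) $ n) * q ^ n" for n
    unfolding fps_mult_nth atLeast0AtMost of_real_sum sum_distrib_right
    by (intro sum.cong) (auto simp: mult_ac simp flip: power_add)
  ultimately show "(\<lambda>n. of_real ((f * g) $ n) * q ^ n) sums (F q * G q)" by simp
qed

lemma disc_eval_power: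
  assumes "disc_eval f F"
  shows "disc_eval (f ^ c) (\<lambda>q. F q ^ c)"
  by (induction c) (auto intro: disc_eval_1 disc_eval_mult assms)

lemma disc_eval_prod:
  assumes "\<And>i. i \<in> I \<Longrightarrow> disc_eval (f i) (F i)"
  shows "disc_eval (\<Prod>i\<in>I. f i) (\<lambda>q. \<Prod>i\<in>I. F i q)"
  using assms by (induction I rule: infinite_finite_induct) (auto intro: disc_eval_1 disc_eval_mult)

lemma disc_eval_geo:
  assumes b: "b > 0"
  shows "disc_eval (geo b) (\<lambda>q. 1 / (1 - q ^ b))"
  unfolding disc_eval_def
proof (intro allI impI)
  fix q :: complex assume q: "norm q < 1"
  have "norm (q ^ b) < 1"
    using q b power_less_one_iff[of "norm q" b] by (simp add: norm_power)
  then have "(\<lambda>n. (q ^ b) ^ n) sums (1 / (1 - q ^ b))" by (rule geometric_sums)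
  then have "(\<lambda>n. of_real (geo b $ (b * n)) * q ^ (b * n)) sums (1 / (1 - q ^ b))"
    by (simp add: geo_def power_mult)
  then show "(\<lambda>n. of_real (geo b $ n) * q ^ n) sums (1 / (1 - q ^ b))"
    using b by (subst (asm) sums_mono_reindex) (auto simp: strict_mono_def geo_def elim: dvdE)
qed

lemma disc_eval_partition_prod:
  "disc_eval (partition_prod k e K) (\<lambda>q. \<Prod>m=1..k. (\<Prod>n\<le>K. 1 / (1 - (q ^ m) ^ Suc n)) ^ nat (e m))"
proof -
  have "disc_eval (partition_prod k e K) (\<lambda>q. \<Prod>m=1..k. \<Prod>n\<le>K. (1 / (1 - q ^ (m * Suc n))) ^ nat (e m))"
    unfolding partition_prod_def by (intro disc_eval_prod disc_eval_power disc_eval_geo) auto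
  then show ?thesis by (simp only: power_mult prod_power_distrib)
qed

section \<open>Monotone passage to the infinite product\<close>

lemma fps_mult_nth_ge:
  fixes f g :: "real fps"
  assumes "\<And>n. f $ n \<ge> 0" "\<And>n. g $ n \<ge> 0" "g $ 0 = 1"
  shows "f $ n \<le> (f * g) $ n"
proof -
  have "f $ n = (\<Sum>i\<in>{n}. f $ i * g $ (n - i))" using assms by simp
  also have "\<dots> \<le> (\<Sum>i=0..n. f $ i * g $ (n - i))"
    using assms by (intro sum_mono2) auto
  finally show ?thesis by (simp add: fps_mult_nth)
qed

lemma fps_nth_prod_nonneg:
  fixes f :: "'a \<Rightarrow> real fps"
  assumes "\<And>i n. i \<in> I \<Longrightarrow> f i $ n \<ge> 0"
  shows "(\<Prod>i\<in>I. f i) $ n \<ge> 0"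
  using assms
  by (induction I arbitrary: n rule: infinite_finite_induct) (auto simp: fps_mult_nth intro!: sum_nonneg)

lemma fps_nth_prod_0:
  fixes f :: "'a \<Rightarrow> real fps"
  shows "(\<Prod>i\<in>I. f i) $ 0 = (\<Prod>i\<in>I. f i $ 0)"
  by (induction I rule: infinite_finite_induct) auto

lemma geo_power_nth_nonneg: "(geo b ^ c) $ n \<ge> 0"
  using fps_nth_prod_nonneg[of "{..<c}" "\<lambda>_. geo b" n] by (simp add: geo_def)

lemma partition_prod_nth_nonneg: "partition_prod k e K $ n \<ge> 0"
  unfolding partition_prod_def by (intro fps_nth_prod_nonneg geo_power_nth_nonneg)

text \<open>The additional factors have nonnegative coefficients and constant coefficient 1, so no
  coefficient can decrease.\<close>

lemma partition_prod_nth_mono: 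
  assumes "K \<le> L"
  shows "partition_prod k e K $ n \<le> partition_prod k e L $ n"
  using assms
proof (induction L rule: dec_induct)
  case (step L)
  define g where "g = (\<Prod>m=1..k. geo (m * Suc (Suc L)) ^ nat (e m))"
  have "partition_prod k e (Suc L) = partition_prod k e L * g"
    by (simp add: partition_prod_def g_def prod.distrib)
  moreover have "g $ n \<ge> 0" for n
    unfolding g_def by (intro fps_nth_prod_nonneg geo_power_nth_nonneg)
  moreover have "g $ 0 = 1"
    unfolding g_def fps_nth_prod_0 by (intro prod.neutral) (auto simp: fps_nth_power_0 geo_def)
  ultimately have "partition_prod k e L $ n \<le> partition_prod k e (Suc L) $ n"
    using fps_mult_nth_ge partition_prod_nth_nonneg by metis
  with step show ?case by simp
qed simp

text \<open>The coefficients of the finite products increase to \<open>gen_partition\<close>. At a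
  real point their values converge, hence are bounded, which bounds the partial sums of the limit
  series. That series then serves as majorant for Tannery's theorem at complex points.\<close>

lemma
  assumes e: "\<And>m. m \<in> {1..k} \<Longrightarrow> e m \<ge> 0"
  shows gen_partition_nonneg: "gen_partition k e N \<ge> 0"
    and disc_eval_gen_partition:
      "disc_eval (Abs_fps (gen_partition k e)) (\<lambda>q. \<Prod>m=1..k. exp (plog (q ^ m)) ^ nat (e m))"
proof -
  define a where "a = gen_partition k e"
  define F where "F = (\<lambda>q::complex. \<Prod>m=1..k. exp (plog (q ^ m)) ^ nat (e m))"
  define G where "G = (\<lambda>K (q::complex). \<Prod>m=1..k. (\<Prod>n\<le>K. 1 / (1 - (q ^ m) ^ Suc n)) ^ nat (e m))"
  have ev: "\<forall>\<^sub>F K in sequentially. partition_prod k e K $ N = a N" for N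
    unfolding a_def by (intro eventually_partition_prod_nth e)
  have le: "partition_prod k e K $ N \<le> a N" for K N
  proof -
    obtain L where "L \<ge> K" "partition_prod k e L $ N = a N"
      using eventually_conj[OF ev[of N] eventually_ge_at_top[of K]] by (metis (mono_tags, lifting) eventually_sequentially order_refl)
    then show ?thesis using partition_prod_nth_mono[of K L k e N] by simp
  qed
  have nonneg: "a N \<ge> 0" for N using le[of 0 N] partition_prod_nth_nonneg[of k e 0 N] by linarith
  then show "gen_partition k e N \<ge> 0" by (simp add: a_def)
  have lim: "(\<lambda>K. G K q) \<longlonglongrightarrow> F q" if "norm q < 1" for q
    unfolding F_def G_def using that
    by (intro tendsto_prod tendsto_power prod_tendsto_exp_plog) (auto simp: norm_power power_less_one_iff)
  have summ: "summable (\<lambda>N. a N * r ^ N)" if r: "0 \<le> r" "r < 1" for r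
  proof -
    have "convergent (\<lambda>K. G K (of_real r))"
      using lim[of "of_real r"] r by (auto intro: convergentI)
    then obtain B where B: "\<And>K. norm (G K (of_real r)) \<le> B"
      using convergent_imp_Bseq by (metis BseqE)
    show ?thesis
    proof (rule summableI_nonneg_bounded)
      fix M
      have "\<forall>\<^sub>F K in sequentially. \<forall>N\<in>{..<M}. partition_prod k e K $ N = a N"
        by (subst eventually_ball_finite_distrib) (use ev in auto)
      \<comment> \<open>\<open>K\<close> depends on the number \<open>M\<close> of coefficients,
        whereas the bound \<open>B\<close> does not.\<close>
      then obtain K where K: "\<And>N. N < M \<Longrightarrow> partition_prod k e K $ N = a N"
        by (auto simp: eventually_sequentially)
      have S: "(\<lambda>N. complex_of_real (partition_prod k e K $ N * r ^ N)) sums G K (of_real r)"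
        using disc_eval_partition_prod[of k e K] r by (simp add: disc_eval_def G_def)
      have S': "summable (\<lambda>N. partition_prod k e K $ N * r ^ N)"
        using sums_summable[OF S] by (simp only: summable_of_real_iff)
      have "(\<Sum>N<M. a N * r ^ N) = (\<Sum>N<M. partition_prod k e K $ N * r ^ N)"
        using K by simp
      also have "\<dots> \<le> (\<Sum>N. partition_prod k e K $ N * r ^ N)"
        using S' r by (intro sum_le_suminf) (auto intro: mult_nonneg_nonneg partition_prod_nth_nonneg)
      also have "\<dots> = Re (G K (of_real r))"
        using sums_Re[OF S] by (simp add: sums_iff)
      also have "\<dots> \<le> B" using complex_Re_le_cmod[of "G K (of_real r)"] B[of K] by linarith
      finally show "(\<Sum>N<M. a N * r ^ N) \<le> B" .
    qed (use nonneg r in auto)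
  qed
  have "(\<lambda>N. of_real (a N) * q ^ N) sums F q" if q: "norm q < 1" for q
  proof -
    have "summable (\<lambda>N. norm (complex_of_real (a N) * q ^ N)) \<and>
        (\<lambda>K. \<Sum>N. of_real (partition_prod k e K $ N) * q ^ N) \<longlonglongrightarrow> (\<Sum>N. of_real (a N) * q ^ N)"
    proof (rule conjunct2[OF tannerys_theorem])
      show "(\<lambda>K. complex_of_real (partition_prod k e K $ N) * q ^ N) \<longlonglongrightarrow> of_real (a N) * q ^ N" for N
        by (rule tendsto_eventually) (use ev[of N] in eventually_elim, simp)
      show "\<forall>\<^sub>F (N, K) in at_top \<times>\<^sub>F at_top. norm (complex_of_real (partition_prod k e K $ N) * q ^ N) \<le> a N * norm q ^ N"
        using le partition_prod_nth_nonneg by (intro always_eventually) (auto simp: norm_mult norm_power intro!: mult_right_mono)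
      show "summable (\<lambda>N. a N * norm q ^ N)" by (intro summ) (use q in auto)
    qed simp
    moreover have "(\<Sum>N. of_real (partition_prod k e K $ N) * q ^ N) = G K q" for K
      using disc_eval_partition_prod[of k e K] q by (simp add: disc_eval_def G_def sums_iff)
    ultimately have "summable (\<lambda>N. norm (complex_of_real (a N) * q ^ N))" "(\<Sum>N. of_real (a N) * q ^ N) = F q"
      using LIMSEQ_unique lim[OF q] by auto
    then show ?thesis using summable_norm_cancel by (auto simp: sums_iff)
  qed
  then show "disc_eval (Abs_fps (gen_partition k e)) (\<lambda>q. \<Prod>m=1..k. exp (plog (q ^ m)) ^ nat (e m))"
    by (simp add: disc_eval_def a_def F_def)
qed

section \<open>Integral formulas\<close>

lemma integral_cis_of_int:
  "has_bochner_integral lborel (\<lambda>t. indicator {- pi..pi} t *\<^sub>R cis (of_int j * t)) (if j = 0 then 2 * pi else 0)"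
proof (cases "j = 0")
  case True
  have "has_bochner_integral lborel (\<lambda>t. indicator {- pi..pi} t *\<^sub>R (1 :: complex)) (of_real pi - of_real (- pi))"
    by (intro has_bochner_integral_FTC_Icc) (auto intro!: derivative_eq_intros)
  with True show ?thesis by simp
next
  case False
  define F where "F = (\<lambda>t. - \<i> / of_int j * cis (of_int j * t))"
  have "(F has_vector_derivative cis (of_int j * t)) (at t within {- pi..pi})" for t
  proof -
    have "((\<lambda>z. - \<i> / of_int j * exp (\<i> * (of_int j * z))) has_field_derivative exp (\<i> * (of_int j * of_real t))) (at (of_real t))"
      using False by (auto intro!: derivative_eq_intros)
    from has_vector_derivative_real_field[OF this] show ?thesis
      by (simp add: F_def cis_conv_exp)
  qed
  then have "has_bochner_integral lborel (\<lambda>t. indicator {- pi..pi} t *\<^sub>R cis (of_int j * t)) (F pi - F (- pi))"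
    by (intro has_bochner_integral_FTC_Icc) (auto intro!: continuous_intros)
  moreover have "F pi = F (- pi)"
    using sin_npi_int[of j] by (simp add: F_def cis.ctr complex_eq_iff mult.commute)
  ultimately show ?thesis using False by simp
qed

text \<open>Orthogonality of the exponentials after termwise integration, which the absolute
  summability of \<open>a\<close> permits. The signs correspond to
  \<open>q = exp (- (x + \<i> * t))\<close>.\<close>

lemma cis_coefficient_integral:
  fixes a :: "nat \<Rightarrow> real"
  assumes a: "\<And>n. a n \<ge> 0" and s: "summable a"
  shows "has_bochner_integral lborel
    (\<lambda>t. indicator {- pi..pi} t *\<^sub>R ((\<Sum>N. of_real (a N) * cis (- (real N * t))) * cis (real n * t))) (of_real (2 * pi * a n))"
proof -
  define h where "h = (\<lambda>N t. of_real (a N) * (indicator {- pi..pi} t *\<^sub>R cis (of_int (int n - int N) * t)))"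
  have h: "has_bochner_integral lborel (h N) (complex_of_real (a N) * complex_of_real (if int n - int N = 0 then 2 * pi else 0))" for N
    unfolding h_def by (intro has_bochner_integral_mult_right integral_cis_of_int)
  have nh: "norm (h N t) = indicator {- pi..pi} t *\<^sub>R a N" for N t
    using a[of N] by (auto simp: h_def norm_mult indicator_def)
  have int_nh: "(\<integral>t. norm (h N t) \<partial>lborel) = 2 * pi * a N" for N
    unfolding nh by simp
  have int: "integrable lborel (h N)" for N using h by (simp add: has_bochner_integral_iff)
  have ae: "AE t in lborel. summable (\<lambda>N. norm (h N t))"
    unfolding nh using s by (intro always_eventually allI) (auto simp: indicator_def)
  have sn: "summable (\<lambda>N. \<integral>t. norm (h N t) \<partial>lborel)"
    unfolding int_nh using s by (intro summable_mult)
  have sum_h: "(\<Sum>N. h N t) = indicator {- pi..pi} t *\<^sub>R ((\<Sum>N. of_real (a N) * cis (- (real N * t))) * cis (real n * t))" for t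
  proof -
    have "summable (\<lambda>N. norm (of_real (a N) * cis (- (real N * t))))"
      using s a by (simp add: norm_mult)
    then have "(\<lambda>N. of_real (a N) * cis (- (real N * t))) sums (\<Sum>N. of_real (a N) * cis (- (real N * t)))"
      by (rule summable_sums[OF summable_norm_cancel])
    from sums_mult[OF this, of "indicator {- pi..pi} t *\<^sub>R cis (real n * t)"]
    have "(\<lambda>N. indicator {- pi..pi} t *\<^sub>R cis (real n * t) * (of_real (a N) * cis (- (real N * t))))
        sums (indicator {- pi..pi} t *\<^sub>R cis (real n * t) * (\<Sum>N. of_real (a N) * cis (- (real N * t))))" .
    moreover have "indicator {- pi..pi} t *\<^sub>R cis (real n * t) * (of_real (a N) * cis (- (real N * t))) = h N t" for N
    proof -
      have "cis (of_int (int n - int N) * t) = cis (real n * t) * cis (- (real N * t))"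
        by (simp add: cis_mult left_diff_distrib)
      then show ?thesis by (simp only: h_def scaleR_conv_of_real mult_ac)
    qed
    ultimately have "(\<lambda>N. h N t) sums (indicator {- pi..pi} t *\<^sub>R cis (real n * t) * (\<Sum>N. of_real (a N) * cis (- (real N * t))))"
      by (simp only:)
    then show ?thesis by (simp add: sums_iff mult_ac)
  qed
  have "(\<lambda>N. integral\<^sup>L lborel (h N)) sums (\<integral>t. (\<Sum>N. h N t) \<partial>lborel)"
    by (rule sums_integral[OF int ae sn])
  moreover have "integral\<^sup>L lborel (h N) = (if N = n then of_real (2 * pi * a n) else 0)" for N
    using h[of N] by (auto simp: has_bochner_integral_iff)
  ultimately have "(\<lambda>N. if N = n then of_real (2 * pi * a n) else 0) sums (\<integral>t. (\<Sum>N. h N t) \<partial>lborel)"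
    by (simp only:)
  moreover have "(\<lambda>N. if N = n then complex_of_real (2 * pi * a n) else 0) sums of_real (2 * pi * a n)"
    by (rule sums_single)
  ultimately have "(\<integral>t. (\<Sum>N. h N t) \<partial>lborel) = of_real (2 * pi * a n)"
    by (rule sums_unique2)
  moreover have "integrable lborel (\<lambda>t. \<Sum>N. h N t)"
    by (rule integrable_suminf[OF int ae sn])
  ultimately show ?thesis by (simp add: has_bochner_integral_iff sum_h)
qed

lemma gaussian_integral:
  assumes "A > 0"
  shows "(\<integral>t. exp (- (A * t\<^sup>2)) \<partial>lborel) = sqrt (pi / A)"
proof -
  \<comment> \<open>The standard deviation for which the normal density has exponent
    \<open>- A * t^2\<close>.\<close>
  define \<sigma> where "\<sigma> = sqrt (1 / (2 * A))"
  have \<sigma>: "\<sigma> > 0" "\<sigma>\<^sup>2 = 1 / (2 * A)" using assms by (auto simp: \<sigma>_def)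
  have nd: "normal_density 0 \<sigma> t = 1 / sqrt (pi / A) * exp (- (A * t\<^sup>2))" for t
    unfolding normal_density_def \<sigma>(2) using assms by simp
  have "(\<integral>t. 1 / sqrt (pi / A) * exp (- (A * t\<^sup>2)) \<partial>lborel) = 1"
    unfolding nd[symmetric] by (rule integral_normal_density[OF \<sigma>(1)])
  then have "1 / sqrt (pi / A) * (\<integral>t. exp (- (A * t\<^sup>2)) \<partial>lborel) = 1"
    by (simp only: integral_mult_right_zero)
  moreover have "y = s" if "1 / s * y = 1" "s > 0" for s y :: real
    using that by (simp add: field_simps)
  ultimately show ?thesis using assms by simp
qed

lemma exp_neg_le_inverse_cube:
  assumes "(y::real) > 0"
  shows "exp (- y) \<le> 27 / y ^ 3"
proof -
  have "y / 3 \<le> exp (y / 3)"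
    using exp_ge_add_one_self[of "y / 3"] by linarith
  then have "(y / 3) ^ 3 \<le> exp (y / 3) ^ 3"
    using assms by (intro power_mono) auto
  also have "\<dots> = exp y" by (simp flip: exp_of_nat_mult)
  finally show ?thesis
    using assms by (simp add: exp_minus field_simps power_divide)
qed

section \<open>The saddle point method\<close>

text \<open>The exponent levels off at \<open>c / x\<close>, but the angle is at most
  \<open>pi\<close>: \<open>(x * t^2)^3\<close> is \<open>t^4\<close> times the squared angle, hence
  at most \<open>pi^2 * t^4\<close>. So for large \<open>t\<close> the exponent still grows at least
  like \<open>\<bar>t\<bar> powr (2 / 3)\<close>, and its inverse cube, which bounds the
  exponential, decays like \<open>1 / t^2\<close>.\<close>

lemma minor_arc_decay:
  fixes c x t :: real
  assumes c: "c > 0" and x: "x > 0" and t: "\<bar>t * (x * sqrt x)\<bar> \<le> pi"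
  shows "exp (- (c * t\<^sup>2 / (1 + x * t\<^sup>2))) \<le> (2 + 216 * (1 + pi\<^sup>2) / c ^ 3) * inverse (1 + t\<^sup>2)"
proof (cases "\<bar>t\<bar> \<le> 1")
  case True
  then have "t\<^sup>2 \<le> 1" by (simp add: abs_square_le_1)
  moreover have "0 < 1 + t\<^sup>2" by (simp add: add_pos_nonneg)
  ultimately have "1 \<le> 2 * inverse (1 + t\<^sup>2)" by (simp add: field_simps)
  also have "\<dots> \<le> (2 + 216 * (1 + pi\<^sup>2) / c ^ 3) * inverse (1 + t\<^sup>2)"
    using c by (intro mult_right_mono) auto
  finally have "1 \<le> (2 + 216 * (1 + pi\<^sup>2) / c ^ 3) * inverse (1 + t\<^sup>2)" .
  moreover have "exp (- (c * t\<^sup>2 / (1 + x * t\<^sup>2))) \<le> 1" using c x by simp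
  ultimately show ?thesis by linarith
next
  case False
  define v where "v = x * t\<^sup>2"
  have t1: "1 \<le> t\<^sup>2" using False by (metis abs_square_le_1 linear)
  have v: "v \<ge> 0" using x by (simp add: v_def)
  have "(t * (x * sqrt x))\<^sup>2 \<le> pi\<^sup>2" using t by (metis abs_ge_zero power2_abs power_mono)
  then have "(t\<^sup>2)\<^sup>2 * (t * (x * sqrt x))\<^sup>2 \<le> (t\<^sup>2)\<^sup>2 * pi\<^sup>2" by (intro mult_left_mono) auto
  moreover have "v ^ 3 = (t\<^sup>2)\<^sup>2 * (t * (x * sqrt x))\<^sup>2"
    using x by (simp add: v_def power_mult_distrib power2_eq_square power3_eq_cube mult_ac)
  ultimately have v3: "v ^ 3 \<le> (t\<^sup>2)\<^sup>2 * pi\<^sup>2" by simp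
  have "(1 + v) ^ 3 \<le> 4 * (1 + v ^ 3)"
  proof -
    \<comment> \<open>\<open>4 * (1 + v^3) - (1 + v)^3\<close> factors as
      \<open>3 * (1 + v) * (1 - v)^2\<close>.\<close>
    have "0 \<le> 3 * (1 + v) * (1 - v)\<^sup>2" using v by simp
    then show ?thesis by (simp add: power2_eq_square power3_eq_cube algebra_simps)
  qed
  also have "\<dots> \<le> 4 * ((t\<^sup>2)\<^sup>2 + (t\<^sup>2)\<^sup>2 * pi\<^sup>2)"
    using v3 t1 one_le_power[of "t\<^sup>2" 2] by simp
  finally have "(1 + v) ^ 3 \<le> 4 * (1 + pi\<^sup>2) * (t\<^sup>2)\<^sup>2" by (simp add: algebra_simps)
  then have "27 * (1 + v) ^ 3 / (c * t\<^sup>2) ^ 3 \<le> 27 * (4 * (1 + pi\<^sup>2) * (t\<^sup>2)\<^sup>2) / (c * t\<^sup>2) ^ 3"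
    using c by (intro divide_right_mono mult_left_mono) auto
  also have "\<dots> = 108 * (1 + pi\<^sup>2) / c ^ 3 * (1 / t\<^sup>2)"
    using t1 by (simp add: power_mult_distrib power2_eq_square power3_eq_cube)
  also have "\<dots> \<le> 108 * (1 + pi\<^sup>2) / c ^ 3 * (2 * inverse (1 + t\<^sup>2))"
    using t1 c by (intro mult_left_mono) (auto simp: divide_simps)
  also have "\<dots> \<le> (2 + 216 * (1 + pi\<^sup>2) / c ^ 3) * inverse (1 + t\<^sup>2)"
    by (simp add: algebra_simps)
  finally have "27 * (1 + v) ^ 3 / (c * t\<^sup>2) ^ 3 \<le> (2 + 216 * (1 + pi\<^sup>2) / c ^ 3) * inverse (1 + t\<^sup>2)" .
  moreover have "exp (- (c * t\<^sup>2 / (1 + v))) \<le> 27 / (c * t\<^sup>2 / (1 + v)) ^ 3"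
    using c t1 v by (intro exp_neg_le_inverse_cube divide_pos_pos mult_pos_pos) auto
  moreover have "27 / (c * t\<^sup>2 / (1 + v)) ^ 3 = 27 * (1 + v) ^ 3 / (c * t\<^sup>2) ^ 3"
    by (simp add: power_divide)
  ultimately show ?thesis unfolding v_def by linarith
qed

locale primitive_exponents =
  fixes k :: nat and e :: "nat \<Rightarrow> int"
  assumes e_nonneg: "\<And>m. m \<in> {1..k} \<Longrightarrow> e m \<ge> 0"
    and Gcd_support: "Gcd {m \<in> {1..k}. e m \<noteq> 0} = 1"
begin

definition gf :: "complex \<Rightarrow> complex" where
  "gf q = (\<Prod>m=1..k. exp (plog (q ^ m)) ^ nat (e m))"

text \<open>The value of \<open>gf\<close> at \<open>exp (- x)\<close>, kept as a real number to
  serve as normalization and in bounds.\<close>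

definition gfr :: "real \<Rightarrow> real" where
  "gfr x = exp (\<Sum>m=1..k. real_of_int (e m) * plog (exp (- (real m * x))))"

definition A :: real where
  "A = pi\<^sup>2 / 6 * (\<Sum>m=1..k. real_of_int (e m) / real m)"

text \<open>\<open>Gcd {}\<close> is 0, so the gcd condition excludes the zero vector.\<close>

lemma support_nonempty: "{m \<in> {1..k}. e m \<noteq> 0} \<noteq> {}"
  using Gcd_support by (metis Gcd_empty zero_neq_one)

lemma k_pos: "k > 0"
  using support_nonempty by auto

lemma A_pos: "A > 0"
proof -
  obtain m where m: "m \<in> {1..k}" "e m \<noteq> 0" using support_nonempty by blast
  have "(\<Sum>m=1..k. real_of_int (e m) / real m) > 0"
  proof (rule sum_pos2[OF _ m(1)])
    show "real_of_int (e m) / real m > 0"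
      using m e_nonneg[OF m(1)] by (intro divide_pos_pos) auto
  qed (use e_nonneg in auto)
  then show ?thesis by (simp add: A_def)
qed

lemma gf_eq: "gf q = exp (\<Sum>m=1..k. of_int (e m) * plog (q ^ m))"
proof -
  have "exp (plog (q ^ m)) ^ nat (e m) = exp (of_int (e m) * plog (q ^ m))" if "m \<in> {1..k}" for m
    using e_nonneg[OF that] by (simp flip: exp_of_nat_mult)
  then show ?thesis by (simp add: gf_def exp_sum)
qed

lemma gfr_eq: "gfr x = (\<Prod>m=1..k. exp (plog (exp (- (real m * x)))) ^ nat (e m))"
proof -
  have "exp (plog (exp (- (real m * x)))) ^ nat (e m) = exp (of_int (e m) * plog (exp (- (real m * x))))" if "m \<in> {1..k}" for m
    using e_nonneg[OF that] by (simp flip: exp_of_nat_mult)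
  then show ?thesis by (simp add: gfr_def exp_sum)
qed

lemma exp_Complex_power: "exp (- Complex x t) ^ m = exp (- Complex (real m * x) (real m * t))"
  unfolding exp_of_nat_mult[symmetric] by (simp add: Complex_eq algebra_simps)

lemma gen_partition_fourier:
  assumes x: "x > 0"
  shows "has_bochner_integral lborel
    (\<lambda>t. indicator {- pi..pi} t *\<^sub>R (gf (exp (- Complex x t)) * cis (real n * t)))
    (of_real (2 * pi * (gen_partition k e n * exp (- (real n * x)))))"
proof -
  define a where "a = (\<lambda>N. gen_partition k e N * exp (- (real N * x)))"
  have S: "(\<lambda>N. of_real (a N) * cis (- (real N * t))) sums gf (exp (- Complex x t))" for t
  proof -
    have "of_real (gen_partition k e N) * exp (- Complex x t) ^ N = of_real (a N) * cis (- (real N * t))" for N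
      unfolding exp_Complex_power by (simp add: a_def exp_eq_polar mult_ac)
    moreover have "(\<lambda>N. of_real (gen_partition k e N) * exp (- Complex x t) ^ N) sums gf (exp (- Complex x t))"
      using disc_eval_gen_partition[OF e_nonneg] x by (simp add: disc_eval_def gf_def)
    ultimately show ?thesis by simp
  qed
  have "summable a"
    using sums_summable[OF S[of 0]] by (simp add: summable_of_real_iff)
  moreover have "a N \<ge> 0" for N
    using gen_partition_nonneg[OF e_nonneg] by (simp add: a_def)
  ultimately show ?thesis
    using cis_coefficient_integral[of a n] S by (simp add: sums_iff a_def)
qed

lemma norm_gf_le:
  assumes x: "x > 0"
  shows "norm (gf (exp (- Complex x t))) \<le> gfr x * exp (- (\<Sum>m=1..k. real_of_int (e m) *
     (exp (- (real m * x)) / (1 - exp (- (real m * x))) - Re (rcis (exp (- (real m * x))) (- (real m * t)) / (1 - rcis (exp (- (real m * x))) (- (real m * t)))))) / 4)"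
proof -
  define g where "g = (\<lambda>m. exp (- (real m * x)) / (1 - exp (- (real m * x))) - Re (rcis (exp (- (real m * x))) (- (real m * t)) / (1 - rcis (exp (- (real m * x))) (- (real m * t)))))"
  have "norm (gf (exp (- Complex x t))) = (\<Prod>m=1..k. norm (exp (plog (exp (- Complex x t) ^ m))) ^ nat (e m))"
    by (simp only: gf_def prod_norm[symmetric] norm_power)
  also have "\<dots> \<le> (\<Prod>m=1..k. (exp (plog (exp (- (real m * x)))) * exp (- g m / 4)) ^ nat (e m))"
  proof (intro prod_mono conjI zero_le_power norm_ge_zero power_mono)
    fix m assume "m \<in> {1..k}"
    then have nz: "norm (exp (- Complex (real m * x) (real m * t))) < 1" using x by simp
    have "exp (- Complex (real m * x) (real m * t)) = rcis (exp (- (real m * x))) (- (real m * t))"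
      by (simp add: exp_eq_polar rcis_def)
    with norm_exp_plog_le[OF nz]
    show "norm (exp (plog (exp (- Complex x t) ^ m))) \<le> exp (plog (exp (- (real m * x)))) * exp (- g m / 4)"
      by (simp add: exp_Complex_power g_def)
  qed
  also have "\<dots> = gfr x * (\<Prod>m=1..k. exp (- g m / 4) ^ nat (e m))"
    by (simp add: gfr_eq power_mult_distrib prod.distrib)
  also have "(\<Prod>m=1..k. exp (- g m / 4) ^ nat (e m)) = (\<Prod>m=1..k. exp (- (real_of_int (e m) * g m) / 4))"
    using e_nonneg by (intro prod.cong refl) (simp flip: exp_of_nat_mult)
  also have "\<dots> = exp (- (\<Sum>m=1..k. real_of_int (e m) * g m) / 4)"
    by (simp only: exp_sum[OF finite_atLeastAtMost, symmetric] sum_divide_distrib sum_negf[symmetric])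
  finally show ?thesis by (simp only: g_def)
qed

text \<open>By the Bezout bound some \<open>m\<close> in the support has a chord at
  \<open>m * t\<close> comparable to the chord at \<open>t\<close>. Its gap alone suffices, because
  all gaps are nonnegative and \<open>e m \<ge> 1\<close>.\<close>

lemma norm_gf_decay:
  "\<exists>c>0. \<forall>x t. 0 < x \<longrightarrow> x \<le> 1 / (2 * real k) \<longrightarrow> \<bar>t\<bar> \<le> pi \<longrightarrow>
     norm (gf (exp (- Complex x t))) \<le> gfr x * exp (- (c * t\<^sup>2 / (x * (x\<^sup>2 + t\<^sup>2))))"
proof -
  define S where "S = {m \<in> {1..k}. e m \<noteq> 0}"
  have S: "finite S" "card S \<le> k" "Gcd S = 1" "S \<noteq> {}"
    using Gcd_support support_nonempty card_mono[of "{1..k}" S] unfolding S_def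
    by (simp_all add: subset_eq)
  obtain C where C: "C \<ge> 0" "\<And>t. norm (1 - cis t) \<le> C * (\<Sum>m\<in>S. norm (1 - cis (real m * t)))"
    using norm_one_minus_cis_Gcd[OF S(1)] S(3) by auto
  \<comment> \<open>\<open>C\<close> may vanish; the maximum with 1 keeps \<open>B\<close>
    positive.\<close>
  define B where "B = max 1 ((C * real k)\<^sup>2)"
  have B: "B \<ge> 1" "(C * real k)\<^sup>2 \<le> B" by (auto simp: B_def)
  \<comment> \<open>One constant dominating the coefficients of both \<open>x^2\<close> and
    \<open>t^2\<close> in the denominator reached below.\<close>
  define K where "K = max (pi\<^sup>2 * B * (real k)\<^sup>2) 4"
  have K: "K > 0" "pi\<^sup>2 * B * (real k)\<^sup>2 \<le> K" "4 \<le> K" by (auto simp: K_def)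
  define c where "c = 1 / (4 * real k * K)"
  have "c > 0" using K k_pos by (simp add: c_def)
  moreover have "norm (gf (exp (- Complex x t))) \<le> gfr x * exp (- (c * t\<^sup>2 / (x * (x\<^sup>2 + t\<^sup>2))))"
    if x: "0 < x" "x \<le> 1 / (2 * real k)" and t: "\<bar>t\<bar> \<le> pi" for x t
  proof -
    define g where "g = (\<lambda>m. exp (- (real m * x)) / (1 - exp (- (real m * x))) - Re (rcis (exp (- (real m * x))) (- (real m * t)) / (1 - rcis (exp (- (real m * x))) (- (real m * t)))))"
    define w where "w = (\<lambda>m. 1 - cos (real m * t))"
    have w: "w m \<ge> 0" for m by (simp add: w_def)
    have g: "g m \<ge> w m / (2 * (real m * x) * ((real m * x)\<^sup>2 + 2 * w m))" if "m \<in> {1..k}" for m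
    proof -
      have "real m * x \<le> real k * (1 / (2 * real k))"
        using that x by (intro mult_mono) auto
      also have "\<dots> = 1 / 2" using k_pos by simp
      finally show ?thesis
        using geometric_real_part_gap_ge[of "real m * x" "- (real m * t)"] that x by (simp add: g_def w_def)
    qed
    have g0: "g m \<ge> 0" if "m \<in> {1..k}" for m
      using order_trans[OF _ g[OF that]] w[of m] x by simp
    \<comment> \<open>Take the largest chord: the sum over the support is at most \<open>k\<close>
      times it.\<close>
    obtain m where m: "m \<in> S" "norm (1 - cis t) \<le> C * real k * norm (1 - cis (real m * t))"
    proof -
      define M where "M = Max ((\<lambda>m. norm (1 - cis (real m * t))) ` S)"
      have "M \<in> (\<lambda>m. norm (1 - cis (real m * t))) ` S"
        unfolding M_def using S by (intro Max_in) auto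
      then obtain m where m: "m \<in> S" "M = norm (1 - cis (real m * t))" by blast
      have "(\<Sum>m\<in>S. norm (1 - cis (real m * t))) \<le> real (card S) * M"
        using S by (intro sum_bounded_above) (auto simp: M_def)
      also have "\<dots> \<le> real k * M" using S m by (intro mult_right_mono) auto
      finally have "C * (\<Sum>m\<in>S. norm (1 - cis (real m * t))) \<le> C * (real k * M)"
        using C by (intro mult_left_mono)
      with C(2)[of t] m show ?thesis by (intro that[of m]) auto
    qed
    then have mk: "m \<in> {1..k}" "e m \<ge> 1"
      using e_nonneg[of m] by (auto simp: S_def)
    have "(norm (1 - cis t))\<^sup>2 \<le> (C * real k * norm (1 - cis (real m * t)))\<^sup>2"
      using m by (intro power_mono) auto
    also have "\<dots> = (C * real k)\<^sup>2 * (2 * w m)"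
      by (simp only: power_mult_distrib[of "C * real k"] norm_one_minus_cis_sq w_def)
    also have "\<dots> \<le> B * (2 * w m)" using B w by (intro mult_right_mono) auto
    finally have "1 - cos t \<le> B * w m" by (simp add: norm_one_minus_cis_sq)
    with one_minus_cos_ge[OF t] have "2 * t\<^sup>2 / pi\<^sup>2 \<le> B * w m" by linarith
    define u where "u = 2 * t\<^sup>2 / pi\<^sup>2 / B"
    have u: "0 \<le> u" "u \<le> w m"
      using \<open>2 * t\<^sup>2 / pi\<^sup>2 \<le> B * w m\<close> B by (simp_all add: u_def divide_le_eq mult_ac)
    have "4 * (c * t\<^sup>2 / (x * (x\<^sup>2 + t\<^sup>2))) = t\<^sup>2 / (real k * x * (K * x\<^sup>2 + K * t\<^sup>2))"
    proof -
      have "4 * (1 / (4 * a * K) * T / (x * Y)) = T / (a * x * (K * Y))" for a T Y :: real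
        by simp
      from this[of "real k" "t\<^sup>2" "x\<^sup>2 + t\<^sup>2"] show ?thesis
        unfolding c_def distrib_left[of K, symmetric] .
    qed
    also have "\<dots> \<le> t\<^sup>2 / (real k * x * (pi\<^sup>2 * B * (real k)\<^sup>2 * x\<^sup>2 + 4 * t\<^sup>2))"
      using K k_pos x B
      by (intro divide_left_mono mult_left_mono add_mono mult_right_mono mult_pos_pos add_pos_nonneg) auto
    also have "\<dots> = u / (2 * (real k * x) * ((real k * x)\<^sup>2 + 2 * u))"
    proof -
      define D where "D = pi\<^sup>2 * B"
      have D: "D \<noteq> 0" using B by (simp add: D_def)
      have tu: "t\<^sup>2 = D * (u / 2)" using B by (simp add: u_def D_def)
      have "t\<^sup>2 / (real k * x * (D * (real k)\<^sup>2 * x\<^sup>2 + 4 * t\<^sup>2)) = (D * (u / 2)) / (D * (real k * x * ((real k * x)\<^sup>2 + 2 * u)))"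
        unfolding tu by (simp add: power_mult_distrib algebra_simps)
      also have "\<dots> = (u / 2) / (real k * x * ((real k * x)\<^sup>2 + 2 * u))"
        by (rule mult_divide_mult_cancel_left[OF D])
      finally show ?thesis by (simp add: D_def mult_ac)
    qed
    also have "\<dots> \<le> u / (2 * (real m * x) * ((real m * x)\<^sup>2 + 2 * u))"
      using u mk x by (intro divide_left_mono mult_mono mult_left_mono add_mono power_mono mult_pos_pos add_pos_nonneg) auto
    also have "\<dots> \<le> w m / (2 * (real m * x) * ((real m * x)\<^sup>2 + 2 * w m))"
    proof -
      define y where "y = real m * x"
      have y: "y > 0" using mk x by (simp add: y_def)
      \<comment> \<open>\<open>u / (y^2 + 2 * u)\<close> increases with \<open>u\<close>, so a lower
        bound for \<open>w m\<close> is enough.\<close>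
      have "u / (y\<^sup>2 + 2 * u) \<le> w m / (y\<^sup>2 + 2 * w m)"
      proof (subst frac_le_eq)
        show "y\<^sup>2 + 2 * u \<noteq> 0" "y\<^sup>2 + 2 * w m \<noteq> 0"
          using y u w[of m] by (metis add_pos_nonneg less_irrefl mult_nonneg_nonneg zero_le_numeral zero_less_power)+
        have "u * (y\<^sup>2 + 2 * w m) - w m * (y\<^sup>2 + 2 * u) = (u - w m) * y\<^sup>2" by (simp add: algebra_simps)
        also have "\<dots> \<le> 0" using u by (simp add: mult_nonpos_nonneg)
        finally show "(u * (y\<^sup>2 + 2 * w m) - w m * (y\<^sup>2 + 2 * u)) / ((y\<^sup>2 + 2 * u) * (y\<^sup>2 + 2 * w m)) \<le> 0"
          using u w[of m] by (intro divide_nonpos_nonneg) auto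
      qed
      then have "u / (y\<^sup>2 + 2 * u) / (2 * y) \<le> w m / (y\<^sup>2 + 2 * w m) / (2 * y)"
        using y by (intro divide_right_mono) auto
      then show ?thesis by (simp add: y_def mult_ac)
    qed
    also have "\<dots> \<le> g m" by (rule g[OF mk(1)])
    also have "\<dots> \<le> real_of_int (e m) * g m"
      using mk g0[OF mk(1)] by (simp add: mult_le_cancel_right1)
    also have "\<dots> \<le> (\<Sum>m=1..k. real_of_int (e m) * g m)"
      using mk e_nonneg g0 by (intro member_le_sum) auto
    finally have le: "4 * (c * t\<^sup>2 / (x * (x\<^sup>2 + t\<^sup>2))) \<le> (\<Sum>m=1..k. real_of_int (e m) * g m)" .
    have "y \<le> s / 4" if "4 * y \<le> s" for y s :: real using that by simp
    from this[OF le] have "c * t\<^sup>2 / (x * (x\<^sup>2 + t\<^sup>2)) \<le> (\<Sum>m=1..k. real_of_int (e m) * g m) / 4" .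
    then have "gfr x * exp (- (\<Sum>m=1..k. real_of_int (e m) * g m) / 4) \<le> gfr x * exp (- (c * t\<^sup>2 / (x * (x\<^sup>2 + t\<^sup>2))))"
      by (intro mult_left_mono) (auto simp: gfr_def)
    with norm_gf_le[OF x(1), of t] show ?thesis by (simp only: g_def)
  qed
  ultimately show ?thesis by blast
qed

lemma gf_ratio_tendsto:
  "((\<lambda>x. gf (exp (- Complex x (t * (x * sqrt x)))) / of_real (gfr x) * cis (A * t / sqrt x)) \<longlongrightarrow> of_real (exp (- (A * t\<^sup>2)))) (at_right 0)"
proof -
  \<comment> \<open>The parameter \<open>t / sqrt m\<close> is chosen so that at
    \<open>m * x\<close> the angle becomes \<open>m * t * x powr (3 / 2)\<close>, the one belonging
    to the \<open>m\<close>-th power of \<open>q\<close>.\<close>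
  define L where "L = (\<lambda>m x. plog (exp (- Complex x (t / sqrt (real m) * (x * sqrt x)))) - of_real (plog (exp (- x)))
     + \<i> * of_real (t / sqrt (real m) * pi\<^sup>2 / (6 * sqrt x)))"
  have "((\<lambda>x. exp (\<Sum>m=1..k. of_int (e m) * L m (real m * x))) \<longlongrightarrow>
      exp (\<Sum>m=1..k. of_int (e m) * of_real (- ((t / sqrt (real m))\<^sup>2 * pi\<^sup>2 / 6)))) (at_right 0)"
  proof (intro tendsto_exp tendsto_sum tendsto_mult tendsto_const)
    fix m assume "m \<in> {1..k}"
    then have "filterlim (\<lambda>x. real m * x) (at_right 0) (at_right 0)" by real_asymp
    with plog_increment_tendsto[of "t / sqrt (real m)"]
    show "((\<lambda>x. L m (real m * x)) \<longlongrightarrow> of_real (- ((t / sqrt (real m))\<^sup>2 * pi\<^sup>2 / 6))) (at_right 0)"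
      unfolding L_def by (rule filterlim_compose)
  qed
  also have "(\<Sum>m=1..k. of_int (e m) * of_real (- ((t / sqrt (real m))\<^sup>2 * pi\<^sup>2 / 6))) = complex_of_real (- (A * t\<^sup>2))"
    by (simp add: A_def sum_distrib_left sum_distrib_right power_divide sum_negf field_simps)
  also have "exp (complex_of_real (- (A * t\<^sup>2))) = of_real (exp (- (A * t\<^sup>2)))"
    by (rule exp_of_real)
  finally show ?thesis
  proof (rule Lim_transform_eventually)
    show "\<forall>\<^sub>F x in at_right 0. exp (\<Sum>m=1..k. of_int (e m) * L m (real m * x)) =
        gf (exp (- Complex x (t * (x * sqrt x)))) / of_real (gfr x) * cis (A * t / sqrt x)"
      using eventually_at_right_less
    proof eventually_elim
      case (elim x)
      have L: "L m (real m * x) = plog (exp (- Complex x (t * (x * sqrt x))) ^ m) - of_real (plog (exp (- (real m * x))))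
          + \<i> * of_real (pi\<^sup>2 / 6 * (t / sqrt x) / real m)" if "m \<in> {1..k}" for m
      proof -
        have "t / sqrt (real m) * (real m * x * sqrt (real m * x)) = real m * (t * (x * sqrt x))"
          using that elim by (simp add: real_sqrt_mult)
        moreover have "t / sqrt (real m) * pi\<^sup>2 / (6 * sqrt (real m * x)) = pi\<^sup>2 / 6 * (t / sqrt x) / (sqrt (real m) * sqrt (real m))"
          unfolding real_sqrt_mult by (simp add: mult_ac)
        then have "t / sqrt (real m) * pi\<^sup>2 / (6 * sqrt (real m * x)) = pi\<^sup>2 / 6 * (t / sqrt x) / real m"
          by simp
        ultimately show ?thesis
          unfolding L_def exp_Complex_power by simp
      qed
      have "(\<Sum>m=1..k. of_int (e m) * L m (real m * x)) =
         (\<Sum>m=1..k. of_int (e m) * plog (exp (- Complex x (t * (x * sqrt x))) ^ m))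
         - of_real (\<Sum>m=1..k. real_of_int (e m) * plog (exp (- (real m * x)))) + \<i> * of_real (A * t / sqrt x)"
      proof -
        have A: "A * t / sqrt x = (\<Sum>m=1..k. real_of_int (e m) * (pi\<^sup>2 / 6 * (t / sqrt x) / real m))"
          unfolding A_def sum_distrib_left sum_distrib_right sum_divide_distrib
          by (intro sum.cong) (auto simp: mult_ac)
        have "(\<Sum>m=1..k. of_int (e m) * L m (real m * x)) =
          (\<Sum>m=1..k. of_int (e m) * plog (exp (- Complex x (t * (x * sqrt x))) ^ m)
             - of_real (real_of_int (e m) * plog (exp (- (real m * x))))
             + \<i> * of_real (real_of_int (e m) * (pi\<^sup>2 / 6 * (t / sqrt x) / real m)))"
          by (intro sum.cong refl) (simp only: L of_real_mult of_real_of_int_eq ring_distribs mult.left_commute)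
        then show ?thesis
          unfolding A by (simp only: sum.distrib sum_subtractf of_real_sum sum_distrib_left)
      qed
      then show ?case
        by (simp add: exp_add exp_diff gf_eq gfr_def cis_conv_exp exp_of_real del: of_real_sum)
    qed
  qed
qed

lemma gfr_asymp:
  "((\<lambda>x. gfr x / (exp (A / x) * (\<Prod>m=1..k. (real m * x / (2 * pi)) powr (real_of_int (e m) / 2)))) \<longlongrightarrow> 1) (at_right 0)"
proof -
  define L where "L = (\<lambda>x. plog (exp (- x)) - pi\<^sup>2 / (6 * x) - ln (x / (2 * pi)) / 2)"
  have "((\<lambda>x. exp (\<Sum>m=1..k. real_of_int (e m) * L (real m * x))) \<longlongrightarrow> exp (\<Sum>m=1..k. real_of_int (e m) * 0)) (at_right 0)"
  proof (intro tendsto_exp tendsto_sum tendsto_mult tendsto_const)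
    fix m assume "m \<in> {1..k}"
    then have "filterlim (\<lambda>x. real m * x) (at_right 0) (at_right 0)" by real_asymp
    with plog_exp_asymp show "((\<lambda>x. L (real m * x)) \<longlongrightarrow> 0) (at_right 0)"
      unfolding L_def by (rule filterlim_compose)
  qed
  then have "((\<lambda>x. exp (\<Sum>m=1..k. real_of_int (e m) * L (real m * x))) \<longlongrightarrow> 1) (at_right 0)" by simp
  then show ?thesis
  proof (rule Lim_transform_eventually)
    show "\<forall>\<^sub>F x in at_right 0. exp (\<Sum>m=1..k. real_of_int (e m) * L (real m * x)) =
       gfr x / (exp (A / x) * (\<Prod>m=1..k. (real m * x / (2 * pi)) powr (real_of_int (e m) / 2)))"
      using eventually_at_right_less
    proof eventually_elim
      case (elim x)
      have "(\<Prod>m=1..k. (real m * x / (2 * pi)) powr (real_of_int (e m) / 2)) = (\<Prod>m=1..k. exp (real_of_int (e m) * (ln (real m * x / (2 * pi)) / 2)))"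
        using elim by (intro prod.cong refl) (auto simp: powr_def)
      also have "\<dots> = exp (\<Sum>m=1..k. real_of_int (e m) * (ln (real m * x / (2 * pi)) / 2))"
        by (simp add: exp_sum)
      finally have 1: "(\<Prod>m=1..k. (real m * x / (2 * pi)) powr (real_of_int (e m) / 2)) = exp (\<Sum>m=1..k. real_of_int (e m) * (ln (real m * x / (2 * pi)) / 2))" .
      have 2: "A / x = (\<Sum>m=1..k. real_of_int (e m) * (pi\<^sup>2 / (6 * (real m * x))))"
        unfolding A_def sum_distrib_left sum_divide_distrib by (intro sum.cong) (auto simp: mult_ac)
      show ?case
        unfolding 1 2 gfr_def exp_add[symmetric] exp_diff[symmetric] L_def right_diff_distrib sum_subtractf
        by (simp add: algebra_simps)
    qed
  qed
qed

section \<open>Saddle point and dominated convergence\<close>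

text \<open>The saddle point: the minimum of \<open>x \<mapsto> exp (A / x + n * x)\<close>.\<close>

definition saddle :: "nat \<Rightarrow> real" where
  "saddle n = sqrt (A / real n)"

lemma saddle_pos: "n > 0 \<Longrightarrow> saddle n > 0"
  using A_pos by (simp add: saddle_def)

lemma saddle_at_right_0: "filterlim saddle (at_right 0) sequentially"
  unfolding filterlim_at
proof
  show "\<forall>\<^sub>F n in sequentially. saddle n \<in> {0<..} \<and> saddle n \<noteq> 0"
    using eventually_gt_at_top[of 0]
  proof eventually_elim
    case (elim n)
    then show ?case using saddle_pos[of n] by simp
  qed
  have "(\<lambda>n. sqrt (A / real n)) \<longlonglongrightarrow> sqrt 0"
    by (rule tendsto_real_sqrt[OF lim_const_over_n])
  then show "saddle \<longlonglongrightarrow> 0" by (simp add: saddle_def[abs_def])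
qed

text \<open>Since \<open>n * x^2 = A\<close> at the saddle, the Fourier phase is exactly the
  divergent linear phase compensated in \<open>gf_ratio_tendsto\<close>.\<close>

lemma saddle_freq:
  assumes "n > 0"
  shows "real n * (t * (saddle n * sqrt (saddle n))) = A * t / sqrt (saddle n)"
proof -
  define x where "x = saddle n"
  have x: "x > 0" using saddle_pos[OF assms] by (simp add: x_def)
  have "x * x = A / real n" using A_pos by (simp add: x_def saddle_def)
  then have A: "A = real n * (x * x)" using assms by simp
  have "x / sqrt x = sqrt x" using x by (simp add: real_div_sqrt)
  then have "A * t / sqrt x = real n * t * x * sqrt x"
    unfolding A by (metis (no_types, opaque_lifting) mult.commute mult.left_commute times_divide_eq_right)
  then show ?thesis by (simp add: x_def mult_ac)
qed

text \<open>The Fourier integrand divided by its value at \<open>0\<close>, in the variable \<open>t\<close> with angle \<open>t * x powr (3 / 2)\<close>,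
  \<open>x = saddle n\<close>: this is the scale on which it becomes Gaussian.\<close>

definition normalized :: "nat \<Rightarrow> real \<Rightarrow> complex" where
  "normalized n t = indicator {- pi..pi} (t * (saddle n * sqrt (saddle n))) *\<^sub>R
     (gf (exp (- Complex (saddle n) (t * (saddle n * sqrt (saddle n))))) / of_real (gfr (saddle n))
      * cis (real n * (t * (saddle n * sqrt (saddle n)))))"

lemma gfr_pos: "gfr x > 0"
  by (simp add: gfr_def)

lemma normalized_integral:
  assumes n: "n > 0"
  shows "has_bochner_integral lborel (normalized n) (of_real
    (2 * pi * (gen_partition k e n * exp (- (real n * saddle n))) / (saddle n * sqrt (saddle n) * gfr (saddle n))))"
proof -
  define x s where "x = saddle n" and "s = x * sqrt x"
  have x: "x > 0" "s > 0" using saddle_pos[OF n] by (auto simp: x_def s_def)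
  have "has_bochner_integral lborel
      (\<lambda>t. indicator {- pi..pi} (0 + s * t) *\<^sub>R (gf (exp (- Complex x (0 + s * t))) * cis (real n * (0 + s * t))))
      (of_real (2 * pi * (gen_partition k e n * exp (- (real n * x)))) /\<^sub>R \<bar>s\<bar>)"
    by (rule lborel_has_bochner_integral_real_affine_iff[THEN iffD1, OF _ gen_partition_fourier[OF x(1)]])
       (use x in simp)
  then have "has_bochner_integral lborel
      (\<lambda>t. (indicator {- pi..pi} (0 + s * t) *\<^sub>R (gf (exp (- Complex x (0 + s * t))) * cis (real n * (0 + s * t)))) / of_real (gfr x))
      (of_real (2 * pi * (gen_partition k e n * exp (- (real n * x)))) /\<^sub>R \<bar>s\<bar> / of_real (gfr x))"
    by (intro has_bochner_integral_divide)
  moreover have "(indicator {- pi..pi} (0 + s * t) *\<^sub>R (gf (exp (- Complex x (0 + s * t))) * cis (real n * (0 + s * t)))) / of_real (gfr x) = normalized n t" for t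
    by (simp add: normalized_def s_def x_def mult.commute[of t] scaleR_conv_of_real)
  moreover have "complex_of_real (2 * pi * (gen_partition k e n * exp (- (real n * x)))) /\<^sub>R \<bar>s\<bar> / of_real (gfr x)
      = of_real (2 * pi * (gen_partition k e n * exp (- (real n * x))) / (s * gfr x))"
    using x by (simp add: scaleR_conv_of_real divide_inverse mult_ac)
  ultimately show ?thesis by (simp add: s_def x_def)
qed

lemma normalized_tendsto: "(\<lambda>n. normalized n t) \<longlonglongrightarrow> of_real (exp (- (A * t\<^sup>2)))"
proof (rule Lim_transform_eventually)
  show "(\<lambda>n. gf (exp (- Complex (saddle n) (t * (saddle n * sqrt (saddle n))))) / of_real (gfr (saddle n)) * cis (A * t / sqrt (saddle n)))
    \<longlonglongrightarrow> of_real (exp (- (A * t\<^sup>2)))"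
    by (rule filterlim_compose[OF gf_ratio_tendsto saddle_at_right_0])
  have "saddle \<longlonglongrightarrow> 0" using saddle_at_right_0 by (simp add: filterlim_at)
  then have "(\<lambda>n. \<bar>t * (saddle n * sqrt (saddle n))\<bar>) \<longlonglongrightarrow> \<bar>t * (0 * sqrt 0)\<bar>"
    by (intro tendsto_intros)
  \<comment> \<open>For fixed \<open>t\<close> the angle tends to 0, so the indicator is eventually
    1.\<close>
  then have "\<forall>\<^sub>F n in sequentially. \<bar>t * (saddle n * sqrt (saddle n))\<bar> < pi"
    by (rule order_tendstoD) simp
  then show "\<forall>\<^sub>F n in sequentially. gf (exp (- Complex (saddle n) (t * (saddle n * sqrt (saddle n))))) / of_real (gfr (saddle n)) * cis (A * t / sqrt (saddle n))
     = normalized n t"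
    using eventually_gt_at_top[of 0]
  proof eventually_elim
    case (elim n)
    then have "t * (saddle n * sqrt (saddle n)) \<in> {- pi..pi}" by auto
    with elim show ?case by (simp only: normalized_def saddle_freq) simp
  qed
qed

text \<open>Substituting \<open>\<theta>^2 = x^3 * t^2\<close> turns the exponent of
  \<open>norm_gf_decay\<close> into that of \<open>minor_arc_decay\<close>. The bound holds only
  eventually because \<open>saddle n\<close> must not exceed \<open>1 / (2 * k)\<close>.\<close>

lemma normalized_dominated:
  "\<exists>M. \<forall>\<^sub>F n in sequentially. \<forall>t. norm (normalized n t) \<le> M * inverse (1 + t\<^sup>2)"
proof -
  obtain c where c: "c > 0" and decay: "\<And>x t. 0 < x \<Longrightarrow> x \<le> 1 / (2 * real k) \<Longrightarrow> \<bar>t\<bar> \<le> pi \<Longrightarrow>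
     norm (gf (exp (- Complex x t))) \<le> gfr x * exp (- (c * t\<^sup>2 / (x * (x\<^sup>2 + t\<^sup>2))))"
    using norm_gf_decay by blast
  define M where "M = 2 + 216 * (1 + pi\<^sup>2) / c ^ 3"
  have M: "M \<ge> 0" using c by (simp add: M_def)
  have "saddle \<longlonglongrightarrow> 0" using saddle_at_right_0 by (simp add: filterlim_at)
  then have "\<forall>\<^sub>F n in sequentially. saddle n < 1 / (2 * real k)"
    using k_pos by (intro order_tendstoD) auto
  then have "\<forall>\<^sub>F n in sequentially. \<forall>t. norm (normalized n t) \<le> M * inverse (1 + t\<^sup>2)"
    using eventually_gt_at_top[of 0]
  proof eventually_elim
    case (elim n)
    define x where "x = saddle n"
    have x: "x > 0" "x \<le> 1 / (2 * real k)" using elim saddle_pos[of n] by (auto simp: x_def)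
    show ?case
    proof
      fix t
      define \<theta> where "\<theta> = t * (x * sqrt x)"
      show "norm (normalized n t) \<le> M * inverse (1 + t\<^sup>2)"
      proof (cases "\<bar>\<theta>\<bar> \<le> pi")
        case True
        have \<theta>2: "\<theta>\<^sup>2 = x ^ 3 * t\<^sup>2"
          using x by (simp add: \<theta>_def power_mult_distrib power2_eq_square power3_eq_cube)
        have "c * \<theta>\<^sup>2 / (x * (x\<^sup>2 + \<theta>\<^sup>2)) = x ^ 3 * (c * t\<^sup>2) / (x ^ 3 * (1 + x * t\<^sup>2))"
          unfolding \<theta>2 by (simp add: power2_eq_square power3_eq_cube algebra_simps)
        also have "\<dots> = c * t\<^sup>2 / (1 + x * t\<^sup>2)"
          using x by (intro mult_divide_mult_cancel_left) auto
        finally have eq: "c * \<theta>\<^sup>2 / (x * (x\<^sup>2 + \<theta>\<^sup>2)) = c * t\<^sup>2 / (1 + x * t\<^sup>2)" .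
        have "norm (normalized n t) = norm (gf (exp (- Complex x \<theta>))) / gfr x"
          using True gfr_pos[of x] by (auto simp: normalized_def norm_mult norm_divide indicator_def abs_le_iff simp flip: x_def \<theta>_def)
        also have "\<dots> \<le> exp (- (c * \<theta>\<^sup>2 / (x * (x\<^sup>2 + \<theta>\<^sup>2))))"
          using decay[OF x True] gfr_pos[of x] by (simp add: divide_le_eq mult.commute)
        also have "\<dots> \<le> M * inverse (1 + t\<^sup>2)"
          unfolding eq M_def by (rule minor_arc_decay[OF c x(1) True[unfolded \<theta>_def]])
        finally show ?thesis .
      next
        case False
        then have "normalized n t = 0"
          by (auto simp: normalized_def indicator_def abs_le_iff simp flip: x_def \<theta>_def)
        then show ?thesis using M by (simp add: add_nonneg_nonneg)
      qed
    qed
  qed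
  then show ?thesis by blast
qed

lemma integrable_inverse_1_plus_sq: "integrable lborel (\<lambda>t::real. inverse (1 + t\<^sup>2))"
  using integrable_inverse_1_plus_square by (simp add: set_integrable_def)

lemma fourier_coefficient_tendsto:
  "(\<lambda>n. 2 * pi * (gen_partition k e n * exp (- (real n * saddle n))) / (saddle n * sqrt (saddle n) * gfr (saddle n)))
     \<longlonglongrightarrow> sqrt (pi / A)"
proof -
  obtain M N where N: "\<And>n t. n \<ge> N \<Longrightarrow> norm (normalized n t) \<le> M * inverse (1 + t\<^sup>2)"
    using normalized_dominated by (auto simp: eventually_sequentially)
  \<comment> \<open>The shift makes the domination valid for every index and keeps \<open>n\<close>
    positive.\<close>
  define N' where "N' = Suc N"
  define v where "v = (\<lambda>n. 2 * pi * (gen_partition k e n * exp (- (real n * saddle n))) / (saddle n * sqrt (saddle n) * gfr (saddle n)))"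
  have v: "has_bochner_integral lborel (normalized (n + N')) (of_real (v (n + N')))" for n
    unfolding v_def by (rule normalized_integral) (simp add: N'_def)
  have "(\<lambda>n. integral\<^sup>L lborel (normalized (n + N'))) \<longlonglongrightarrow> (\<integral>t. of_real (exp (- (A * t\<^sup>2))) \<partial>lborel)"
  proof (rule integral_dominated_convergence)
    show "integrable lborel (\<lambda>t. M * inverse (1 + t\<^sup>2))"
      by (intro integrable_mult_right integrable_inverse_1_plus_sq)
    show "normalized (n + N') \<in> borel_measurable lborel" for n
      using v by (rule borel_measurable_has_bochner_integral)
    show "AE t in lborel. (\<lambda>n. normalized (n + N') t) \<longlonglongrightarrow> of_real (exp (- (A * t\<^sup>2)))"
      by (intro always_eventually allI LIMSEQ_ignore_initial_segment normalized_tendsto)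
    show "AE t in lborel. norm (normalized (n + N') t) \<le> M * inverse (1 + t\<^sup>2)" for n
      by (intro always_eventually allI N) (simp add: N'_def)
  qed measurable
  then have "(\<lambda>n. complex_of_real (v (n + N'))) \<longlonglongrightarrow> of_real (sqrt (pi / A))"
    using v by (simp add: has_bochner_integral_iff gaussian_integral[OF A_pos] integral_complex_of_real)
  then have "(\<lambda>n. v (n + N')) \<longlonglongrightarrow> sqrt (pi / A)"
    by (simp only: tendsto_of_real_iff)
  then show ?thesis unfolding v_def[symmetric] by (rule LIMSEQ_offset)
qed

theorem gen_partition_asymp:
  defines "\<gamma> \<equiv> \<Sum>m=1..k. real_of_int (e m)"
    and "lam \<equiv> \<Prod>m=1..k. (real m / (2 * pi)) powr (real_of_int (e m) / 2)"
  shows "gen_partition k e \<sim>[at_top]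
    (\<lambda>n. lam * A powr ((1 + \<gamma>) / 4) / (2 * sqrt pi * real n powr ((3 + \<gamma>) / 4))
          * exp (2 * sqrt (A * real n)))"
proof (rule asymp_equivI')
  define P where "P = (\<lambda>x. \<Prod>m=1..k. (real m * x / (2 * pi)) powr (real_of_int (e m) / 2))"
  define v where "v = (\<lambda>n. 2 * pi * (gen_partition k e n * exp (- (real n * saddle n))) / (saddle n * sqrt (saddle n) * gfr (saddle n)))"
  define rhs where "rhs = (\<lambda>n. lam * A powr ((1 + \<gamma>) / 4) / (2 * sqrt pi * real n powr ((3 + \<gamma>) / 4)) * exp (2 * sqrt (A * real n)))"
  have "(\<lambda>n. gfr (saddle n) / (exp (A / saddle n) * P (saddle n))) \<longlonglongrightarrow> 1"
    unfolding P_def by (rule filterlim_compose[OF gfr_asymp saddle_at_right_0])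
  moreover have "v \<longlonglongrightarrow> sqrt (pi / A)"
    unfolding v_def by (rule fourier_coefficient_tendsto)
  ultimately have "(\<lambda>n. gfr (saddle n) / (exp (A / saddle n) * P (saddle n)) * (v n / sqrt (pi / A))) \<longlonglongrightarrow> 1 * (sqrt (pi / A) / sqrt (pi / A))"
    using A_pos by (intro tendsto_intros) auto
  then have "(\<lambda>n. gfr (saddle n) / (exp (A / saddle n) * P (saddle n)) * (v n / sqrt (pi / A))) \<longlonglongrightarrow> 1"
    using A_pos by simp
  then show "(\<lambda>n. gen_partition k e n / rhs n) \<longlonglongrightarrow> 1"
  proof (rule Lim_transform_eventually)
    show "\<forall>\<^sub>F n in sequentially. gfr (saddle n) / (exp (A / saddle n) * P (saddle n)) * (v n / sqrt (pi / A)) = gen_partition k e n / rhs n"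
      using eventually_gt_at_top[of 0]
    proof eventually_elim
      case (elim n)
      define x where "x = saddle n"
      have x: "x > 0" using saddle_pos[OF elim] by (simp add: x_def)
      have lam: "lam > 0" by (auto simp: lam_def intro!: prod_pos)
      have "P x = (\<Prod>m=1..k. (real m / (2 * pi)) powr (real_of_int (e m) / 2) * x powr (real_of_int (e m) / 2))"
        unfolding P_def using x by (intro prod.cong refl) (simp flip: powr_mult)
      also have "\<dots> = lam * x powr (\<gamma> / 2)"
        using x by (simp add: prod.distrib lam_def \<gamma>_def powr_sum sum_divide_distrib)
      finally have P: "P x = lam * x powr (\<gamma> / 2)" .
      \<comment> \<open>At the saddle the two parts of the exponent are equal; together they give
        \<open>2 * sqrt (A * n)\<close>.\<close>
      have nx: "real n * x = sqrt (A * real n)" "A / x = sqrt (A * real n)"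
        using A_pos elim by (simp_all add: x_def saddle_def real_sqrt_divide real_sqrt_mult field_simps)
      have xp: "x = A powr (1 / 2) / real n powr (1 / 2)"
        using A_pos by (simp add: x_def saddle_def real_sqrt_divide powr_half_sqrt)
      have "x * sqrt x * x powr (\<gamma> / 2) = x powr 1 * x powr (1 / 2) * x powr (\<gamma> / 2)"
        using x by (simp add: powr_half_sqrt)
      also have "\<dots> = x powr ((3 + \<gamma>) / 2)"
        unfolding powr_add[symmetric] by (simp add: field_simps)
      also have "\<dots> = A powr ((3 + \<gamma>) / 4) / real n powr ((3 + \<gamma>) / 4)"
        unfolding xp using A_pos by (simp add: powr_divide powr_powr)
      \<comment> \<open>The split-off \<open>sqrt A\<close> cancels the one coming from
        \<open>sqrt (pi / A)\<close>.\<close>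
      also have "A powr ((3 + \<gamma>) / 4) = A powr ((1 + \<gamma>) / 4 + 1 / 2)" by (simp add: field_simps)
      also have "\<dots> = A powr ((1 + \<gamma>) / 4) * sqrt A"
        using A_pos by (simp add: powr_add powr_half_sqrt)
      finally have pw: "x * sqrt x * x powr (\<gamma> / 2) = A powr ((1 + \<gamma>) / 4) * sqrt A / real n powr ((3 + \<gamma>) / 4)" .
      define E where "E = exp (sqrt (A * real n))"
      have E: "E > 0" "exp (2 * sqrt (A * real n)) = E * E" "exp (- (real n * x)) = 1 / E" "exp (A / x) = E"
        by (simp_all add: E_def nx exp_minus inverse_eq_divide flip: exp_add)
      define R where "R = A powr ((1 + \<gamma>) / 4) / real n powr ((3 + \<gamma>) / 4)"
      have R: "R > 0" using A_pos elim by (simp add: R_def)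
      have "gfr x / (exp (A / x) * P x) * (v n / sqrt (pi / A))
          = gen_partition k e n * (2 * pi) * sqrt A / (E * E * lam * (x * sqrt x * x powr (\<gamma> / 2)) * sqrt pi)"
        using gfr_pos[of x] x E lam A_pos unfolding v_def P E(3,4) x_def[symmetric]
        by (simp add: real_sqrt_divide field_simps)
      also have "\<dots> = gen_partition k e n * (2 * (sqrt pi * sqrt pi)) * sqrt A / (E * E * lam * (R * sqrt A) * sqrt pi)"
        unfolding pw by (simp add: R_def)
      also have "\<dots> = gen_partition k e n / rhs n"
        using A_pos E R lam unfolding rhs_def E(2) by (simp add: R_def field_simps)
      finally show ?case by (simp only: x_def)
    qed
  qed
qed

end

section \<open>Reduction to exponents whose support has gcd 1\<close>

theorem theorem1p1:
  fixes k d :: nat and e :: "nat \<Rightarrow> int" and \<gamma> \<delta> lam A :: real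
  assumes "\<And>j. j > k \<Longrightarrow> e j = 0"
    and "\<exists>m\<in>{1..k}. e m \<noteq> 0"
    and "\<And>m. m \<in> {1..k} \<Longrightarrow> e m \<ge> 0"
    and "d = Gcd {m \<in> {1..k}. e m \<noteq> 0}"
    and "\<gamma> = (\<Sum>n=1..k div d. real_of_int (e (d * n)))"
    and "\<delta> = (\<Sum>n=1..k div d. real_of_int (e (d * n)) / real n)"
    and "lam = (\<Prod>m=1..k. (real m / (2 * pi)) powr (real_of_int (e (d * m)) / 2))"
    and "A = pi\<^sup>2 * \<delta> / 6"
  shows "(\<lambda>n. gen_partition k e (d * n)) \<sim>[at_top]
    (\<lambda>n. lam * A powr ((1 + \<gamma>) / 4) / (2 * sqrt pi * real n powr ((3 + \<gamma>) / 4))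
          * exp (2 * sqrt (A * real n)))"
proof -
  define S where "S = {m \<in> {1..k}. e m \<noteq> 0}"
  have dvd: "d dvd m" if "m \<in> {1..k}" "e m \<noteq> 0" for m
    using that assms(4) by (auto intro: Gcd_dvd)
  obtain m0 where m0: "m0 \<in> {1..k}" "e m0 \<noteq> 0" using assms(2) by blast
  have d: "d > 0" using dvd[OF m0] m0 by (auto intro!: Nat.gr0I)
  have range: "d * m \<in> {1..k}" if "m \<in> {1..k div d}" for m
    using that d by (auto simp: less_eq_div_iff_mult_less_eq mult.commute Suc_le_eq)
  interpret primitive_exponents "k div d" "\<lambda>m. e (d * m)"
  proof
    fix m assume "m \<in> {1..k div d}"
    then show "e (d * m) \<ge> 0" using range assms(3) by blast
  next
    let ?T = "{m \<in> {1..k div d}. e (d * m) \<noteq> 0}"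
    have "S = (*) d ` ?T"
    proof (intro set_eqI iffI)
      fix m assume m: "m \<in> S"
      then obtain j where j: "m = d * j" using dvd[of m] by (auto simp: S_def elim: dvdE)
      with m d show "m \<in> (*) d ` ?T"
        by (auto simp: S_def less_eq_div_iff_mult_less_eq mult.commute Suc_le_eq)
    next
      fix m assume "m \<in> (*) d ` ?T"
      then show "m \<in> S" using range by (auto simp: S_def)
    qed
    then have "d = d * Gcd ?T"
      using assms(4) Gcd_mult[of d ?T] by (simp add: S_def)
    then show "Gcd ?T = 1" using d by simp
  qed
  \<comment> \<open>For \<open>m > k div d\<close> the index \<open>d * m\<close> exceeds
    \<open>k\<close>, so the exponent is 0. The base is nonzero, hence the factor is 1.\<close>
  have "lam = (\<Prod>m=1..k div d. (real m / (2 * pi)) powr (real_of_int (e (d * m)) / 2))"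
    unfolding assms(7)
  proof (rule prod.mono_neutral_right)
    show "\<forall>m\<in>{1..k} - {1..k div d}. (real m / (2 * pi)) powr (real_of_int (e (d * m)) / 2) = 1"
    proof
      fix m assume m: "m \<in> {1..k} - {1..k div d}"
      then have "k < d * m" using d by (auto simp: div_less_iff_less_mult mult.commute not_le)
      then have "e (d * m) = 0" by (rule assms(1))
      with m show "(real m / (2 * pi)) powr (real_of_int (e (d * m)) / 2) = 1" by simp
    qed
  qed (auto simp: div_le_dividend intro: order_trans[OF _ div_le_dividend])
  moreover have "A = primitive_exponents.A (k div d) (\<lambda>m. e (d * m))"
    unfolding A_def assms(6,8) by simp
  moreover have "(\<lambda>n. gen_partition k e (d * n)) = gen_partition (k div d) (\<lambda>m. e (d * m))"
    by (intro ext gen_partition_dilate d assms(3) dvd)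
  ultimately show ?thesis
    using gen_partition_asymp by (simp only: assms(5))
qed

end
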